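(* Let $\mathbb{E} = \langle B,t;\,t^{-1}Ht = K,\,\varphi\rangle$ be an HNN-extension such that $H$ and $K$ are normal in $B$ and $L\varphi = L$, where $L = H\cap K$. Let $\mathcal{C}$ be a class of groups closed under taking subgroups, quotient groups, and direct products of a finite number of factors. Suppose that at least one of the following statements holds: (a) $\mathfrak{U}=\mathfrak{H}$ or $\mathfrak{U}=\mathfrak{K}$; (b) $H$ and $K$ satisfy a non-trivial identity; (c) $\mathfrak{H}$ satisfies a non-trivial identity; (d) $\mathfrak{K}$ satisfies a non-trivial identity. If $\mathbb{E}$ is residually a $\mathcal{C}$-group, then the quotient groups $B/H$ and $B/K$ are residually $\mathcal{C}$-groups.
   Context: Classes of groups are closed under isomorphism. Maps are written on the right and composed from left to right. $\mathbb{E} = \langle B,t;\,t^{-1}Ht = K,\,\varphi\rangle$ denotes the HNN-extension of a group $B$ with stable letter $t$ and subgroups $H,K\leqslant B$ associated according to an isomorphism $\varphi\colon H\to K$ (so $t^{-1}ht = h\varphi$ for $h\in H$); $B$ is identified with its image in $\mathbb{E}$. For a group $X$ with normal subgroup $Y$, $\operatorname{Aut}_X(Y)\leqslant\operatorname{Aut}Y$ is the group of restrictions to $Y$ of all inner automorphisms of $X$; $\operatorname{sgp}\{\cdot\}$ denotes the generated subgroup. With $H,K$ normal in $B$, put $\mathfrak{H}=\operatorname{Aut}_B(H)$, $\mathfrak{K}=\varphi\operatorname{Aut}_B(K)\varphi^{-1}$ and $\mathfrak{U}=\operatorname{sgp}\{\mathfrak{H},\mathfrak{K}\}$ (subgroups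 of $\operatorname{Aut}H$). A group satisfies a non-trivial identity if there is a non-trivial element $w(x_1,\ldots,x_n)$ of a free group that takes the value $1$ under every substitution of elements of the group for $x_1,\ldots,x_n$. A group $X$ is residually a $\mathcal{C}$-group if every non-trivial element of $X$ has non-trivial image under some homomorphism of $X$ onto a group from $\mathcal{C}$. *)

theory Defs
  imports "HOL-Algebra.Bij" "HOL-Algebra.Generated_Groups" "HOL-Algebra.Product_Groups"
begin

section \<open>HNN-extensions\<close>

text \<open>The HNN-extension is the group with generators \<^term>\<open>carrier B\<close> and \<open>t\<close>, and with the
  multiplication table of \<open>B\<close> and \<open>t\<inverse> h t = h\<phi>\<close> (\<open>h \<in> H\<close>) as defining relations: words in the
  generators and \<open>t\<inverse>\<close>, modulo the congruence generated by these relations and by free cancellation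
  of \<open>t\<close>.  The second associated subgroup is \<open>K = \<phi> ` H\<close>, so it is not a separate argument; values
  of \<open>\<phi>\<close> outside \<open>H\<close> are not used.\<close>

datatype 'b hnn_letter = Base 'b | Stable | StableInv

definition hnn_words :: "('b, 'm) monoid_scheme \<Rightarrow> 'b hnn_letter list set" where
  "hnn_words B = lists (Base ` carrier B \<union> {Stable, StableInv})"

inductive hnn_eq ::
  "('b, 'm) monoid_scheme \<Rightarrow> 'b set \<Rightarrow> ('b \<Rightarrow> 'b) \<Rightarrow> 'b hnn_letter list \<Rightarrow> 'b hnn_letter list \<Rightarrow> bool"
  for B :: "('b, 'm) monoid_scheme" and H :: "'b set" and \<phi> :: "'b \<Rightarrow> 'b"
where
  base_one: "hnn_eq B H \<phi> [Base \<one>\<^bsub>B\<^esub>] []"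
| base_mult: "\<lbrakk>a \<in> carrier B; b \<in> carrier B\<rbrakk>
    \<Longrightarrow> hnn_eq B H \<phi> [Base a, Base b] [Base (a \<otimes>\<^bsub>B\<^esub> b)]"
| stable_inv: "hnn_eq B H \<phi> [Stable, StableInv] []"
| inv_stable: "hnn_eq B H \<phi> [StableInv, Stable] []"
| conj: "h \<in> H \<Longrightarrow> hnn_eq B H \<phi> [StableInv, Base h, Stable] [Base (\<phi> h)]"
| refl: "u \<in> hnn_words B \<Longrightarrow> hnn_eq B H \<phi> u u"
| sym: "hnn_eq B H \<phi> u v \<Longrightarrow> hnn_eq B H \<phi> v u"
| trans: "\<lbrakk>hnn_eq B H \<phi> u v; hnn_eq B H \<phi> v w\<rbrakk> \<Longrightarrow> hnn_eq B H \<phi> u w"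
| cong: "\<lbrakk>hnn_eq B H \<phi> u v; x \<in> hnn_words B; y \<in> hnn_words B\<rbrakk>
    \<Longrightarrow> hnn_eq B H \<phi> (x @ u @ y) (x @ v @ y)"

definition hnn_rel ::
  "('b, 'm) monoid_scheme \<Rightarrow> 'b set \<Rightarrow> ('b \<Rightarrow> 'b) \<Rightarrow> ('b hnn_letter list \<times> 'b hnn_letter list) set"
where
  "hnn_rel B H \<phi> = {(u, v). hnn_eq B H \<phi> u v}"

definition HNN ::
  "('b, 'm) monoid_scheme \<Rightarrow> 'b set \<Rightarrow> ('b \<Rightarrow> 'b) \<Rightarrow> 'b hnn_letter list set monoid"
where
  "HNN B H \<phi> =
    \<lparr>carrier = hnn_words B // hnn_rel B H \<phi>,
     monoid.mult = (\<lambda>X Y. hnn_rel B H \<phi> `` {u @ v | u v. u \<in> X \<and> v \<in> Y}),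
     one = hnn_rel B H \<phi> `` {[]}\<rparr>"


section \<open>Groups of automorphisms\<close>

definition Aut_in :: "('b, 'm) monoid_scheme \<Rightarrow> 'b set \<Rightarrow> ('b \<Rightarrow> 'b) set" where
  "Aut_in X Y = (\<lambda>x. \<lambda>y\<in>Y. inv\<^bsub>X\<^esub> x \<otimes>\<^bsub>X\<^esub> y \<otimes>\<^bsub>X\<^esub> x) ` carrier X"

text \<open>Maps act on the right, so \<open>\<phi> \<alpha> \<phi>\<inverse>\<close> applies \<open>\<phi>\<close> first and is a map from \<open>H\<close> to \<open>H\<close>.
  The library group \<^const>\<open>AutoGroup\<close> composes from right to left, i.e. it is the opposite group;
  this changes neither generated subgroups nor the satisfaction of a non-trivial identity.\<close>

definition Aut_pulled ::
  "('b, 'm) monoid_scheme \<Rightarrow> 'b set \<Rightarrow> 'b set \<Rightarrow> ('b \<Rightarrow> 'b) \<Rightarrow> ('b \<Rightarrow> 'b) set"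
where
  "Aut_pulled B H K \<phi> = (\<lambda>\<alpha>. \<lambda>h\<in>H. inv_into H \<phi> (\<alpha> (\<phi> h))) ` Aut_in B K"

definition Aut_joined ::
  "('b, 'm) monoid_scheme \<Rightarrow> 'b set \<Rightarrow> 'b set \<Rightarrow> ('b \<Rightarrow> 'b) \<Rightarrow> ('b \<Rightarrow> 'b) set"
where
  "Aut_joined B H K \<phi> =
    generate (AutoGroup (B\<lparr>carrier := H\<rparr>)) (Aut_in B H \<union> Aut_pulled B H K \<phi>)"


section \<open>Identities\<close>

text \<open>Elements of the free group on \<open>x\<^sub>0, x\<^sub>1, \<dots>\<close> are the freely reduced words, with the empty word
  as the identity element; \<open>(i, True)\<close> stands for \<open>x\<^sub>i\<close> and \<open>(i, False)\<close> for its inverse.\<close>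

definition freely_reduced :: "(nat \<times> bool) list \<Rightarrow> bool" where
  "freely_reduced w \<longleftrightarrow> successively (\<lambda>x y. \<not> (fst x = fst y \<and> snd x \<noteq> snd y)) w"

fun word_value :: "('a, 'm) monoid_scheme \<Rightarrow> (nat \<Rightarrow> 'a) \<Rightarrow> (nat \<times> bool) list \<Rightarrow> 'a" where
  "word_value G g [] = \<one>\<^bsub>G\<^esub>"
| "word_value G g ((i, e) # w) = (if e then g i else inv\<^bsub>G\<^esub> (g i)) \<otimes>\<^bsub>G\<^esub> word_value G g w"

definition satisfies_nontrivial_identity :: "('a, 'm) monoid_scheme \<Rightarrow> bool" where
  "satisfies_nontrivial_identity G \<longleftrightarrow>
    (\<exists>w. freely_reduced w \<and> w \<noteq> [] \<and> (\<forall>g \<in> UNIV \<rightarrow> carrier G. word_value G g w = \<one>\<^bsub>G\<^esub>))"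


section \<open>Classes of groups and residual properties\<close>

text \<open>A class of groups is given by its members on an arbitrary carrier type \<open>'u\<close>; a group on any
  other type belongs to the class if it is isomorphic to one of these.  No class is lost: a class
  closed under subgroups and quotients enters a residual property of a group \<open>E\<close> only through its members
  of cardinality at most \<open>max(|E|, \<aleph>\<^sub>0)\<close>, and \<open>'u\<close> may be taken to be that large.  Closure under
  products demands that the product be isomorphic to a member, so on a finite type \<open>'u\<close> it leaves
  only classes of trivial groups.\<close>

definition group_class :: "('u monoid \<Rightarrow> bool) \<Rightarrow> bool" where
  "group_class \<C> \<longleftrightarrow>
    (\<forall>X. \<C> X \<longrightarrow> group X) \<and> (\<forall>X Y. \<C> X \<longrightarrow> group Y \<longrightarrow> X \<cong> Y \<longrightarrow> \<C> Y)"

definition in_class :: "('u monoid \<Rightarrow> bool) \<Rightarrow> ('a, 'm) monoid_scheme \<Rightarrow> bool" where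
  "in_class \<C> G \<longleftrightarrow> group G \<and> (\<exists>X. \<C> X \<and> X \<cong> G)"

definition subgroup_closed :: "('u monoid \<Rightarrow> bool) \<Rightarrow> bool" where
  "subgroup_closed \<C> \<longleftrightarrow> (\<forall>X S. \<C> X \<longrightarrow> subgroup S X \<longrightarrow> in_class \<C> (X\<lparr>carrier := S\<rparr>))"

definition quotient_closed :: "('u monoid \<Rightarrow> bool) \<Rightarrow> bool" where
  "quotient_closed \<C> \<longleftrightarrow> (\<forall>X N. \<C> X \<longrightarrow> N \<lhd> X \<longrightarrow> in_class \<C> (X Mod N))"

definition finite_product_closed :: "('u monoid \<Rightarrow> bool) \<Rightarrow> bool" where
  "finite_product_closed \<C> \<longleftrightarrow>
    (\<forall>(I :: nat set) X. finite I \<longrightarrow> I \<noteq> {} \<longrightarrow> (\<forall>i\<in>I. \<C> (X i)) \<longrightarrow> in_class \<C> (product_group I X))"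

definition residually :: "('u monoid \<Rightarrow> bool) \<Rightarrow> ('a, 'm) monoid_scheme \<Rightarrow> bool" where
  "residually \<C> G \<longleftrightarrow>
    (\<forall>g \<in> carrier G. g \<noteq> \<one>\<^bsub>G\<^esub> \<longrightarrow> (\<exists>X f. \<C> X \<and> f \<in> epi G X \<and> f g \<noteq> \<one>\<^bsub>X\<^esub>))"

end

theory Submission
  imports Defs
begin

text \<open>Let \<open>b\<close> be an element of \<open>B\<close> outside \<open>H\<close>; the subgroup \<open>K\<close> is treated in the same way, with
  \<open>t\<close> and \<open>t\<inverse>\<close> exchanged.  If \<open>\<sigma>\<close> maps \<open>E\<close> onto a \<open>\<C>\<close>-group, then \<open>B\<sigma> / H\<sigma>\<close> is a \<open>\<C>\<close>-group, so
  \<open>b H\<close> survives in a \<open>\<C>\<close>-quotient of \<open>B / H\<close> (\<open>separating_quotient\<close>) unless \<open>b\<sigma> \<in> H\<sigma>\<close> for every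
  \<open>\<sigma>\<close>, that is, unless \<open>b\<close> lies in the closure of \<open>H\<close>.  Because \<open>E\<close> is residually a \<open>\<C>\<close>-group, an
  equation that holds on \<open>H\<close> holds on its closure: whatever centralizes \<open>H\<close> centralizes the
  closure, and every identity of \<open>H\<close> is an identity on the closure.  The closure is also invariant
  under all elements that normalize \<open>H\<close>, and besides \<open>B\<close> these include the elements
  \<open>t c t\<inverse>\<close> with \<open>c \<in> B\<close>.  Such equations are refuted in \<open>E\<close> by Britton's lemma (\<open>britton\<close>),
  which is proved by van der Waerden's method: \<open>E\<close> acts on normal forms.

  In case (a), say that every automorphism in \<open>\<KK>\<close> lies in \<open>\<HH>\<close>.  Then for each \<open>c \<in> B\<close> some
  \<open>d \<in> B\<close> makes \<open>t c t\<inverse> d\<inverse>\<close> centralize \<open>H\<close>, hence commute with \<open>b\<close>; but by Britton's lemma this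
  is impossible for \<open>c \<notin> K\<close>.  If \<open>\<HH>\<close> lies in \<open>\<KK>\<close> instead, then \<open>d\<close> can be prescribed but \<open>c\<close> cannot;
  the choice \<open>d = b\<close> and the impossibility just noted give \<open>c \<in> K\<close>, whence an element of \<open>B\<close> outside
  \<open>H\<close> centralizes \<open>H\<close>, and this is refuted in the same way (\<open>closure_excludes_if_induced\<close>).

  Cases (c) and (d) reduce to (b): if \<open>w\<close> is an identity of the automorphisms induced on \<open>H\<close>, then
  the values of \<open>w\<close> on \<open>H\<close> are central in \<open>H\<close>, so \<open>[w, x]\<close> with a new variable \<open>x\<close> is an identity of
  \<open>H\<close>.

  In case (b) it suffices to find conjugates \<open>b\<^sub>i = y\<^sub>i b y\<^sub>i\<inverse>\<close> in the closure such that the products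
  \<open>b\<^sub>2\<^sub>i b\<^sub>2\<^sub>i\<^sub>+\<^sub>1\<close> satisfy no identity.  This holds if for \<open>i \<noteq> j\<close> the element \<open>y\<^sub>i\<inverse> y\<^sub>j\<close> has a reduced
  form that begins with \<open>t\<close> and ends with \<open>t\<inverse>\<close> (\<open>spread_conj_no_identity\<close>).  If there are
  \<open>c\<close>, \<open>d\<close> such that \<open>c\<close>, \<open>d\<close> and \<open>c\<inverse> d\<close> lie outside \<open>K\<close>, one can take
  \<open>y\<^sub>i = (t c t\<inverse> b)\<^sup>i (t d t\<inverse>)\<close>.  If \<open>b\<close> lies in the closure of \<open>L = H \<inter> K\<close>, one can take
  \<open>y\<^sub>i = t\<^sup>i a t\<inverse>\<close> with \<open>a \<notin> K\<close>, because \<open>L\<close> is normalized by \<open>t\<close> as well; such \<open>a\<close> exist, since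
  \<open>K = B\<close> would give \<open>L = H\<close> and \<open>H = L\<phi> = K\<close>.  This disposes of \<open>H \<subseteq> K\<close>, where \<open>L = H\<close>.
  The remaining possibility is \<open>B = H K\<close>, where \<open>B / H\<close> is \<open>K / L\<close>: write \<open>b = h k\<close>.  Either \<open>k\<close> lies in
  the closure of \<open>L\<close>, which has just been excluded, or \<open>k L\<close> survives in a \<open>\<C>\<close>-quotient of \<open>K / L\<close>
  (\<open>separated_quotient\<close>).\<close>

section \<open>Words and identities\<close>

definition inverse_word :: "(nat \<times> bool) list \<Rightarrow> (nat \<times> bool) list" where
  "inverse_word w = rev (map (\<lambda>(i, e). (i, \<not> e)) w)"

lemma freely_reduced_inverse_word:
  assumes "freely_reduced w"
  shows "freely_reduced (inverse_word w)"
  using assms unfolding freely_reduced_def inverse_word_def successively_rev successively_map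
  by (rule successively_mono) auto

context group
begin

lemma word_value_closed:
  assumes "g \<in> UNIV \<rightarrow> carrier G"
  shows "word_value G g w \<in> carrier G"
  using assms by (induction w) (auto simp: Pi_iff)

lemma word_value_append:
  assumes "g \<in> UNIV \<rightarrow> carrier G"
  shows "word_value G g (v @ w) = word_value G g v \<otimes> word_value G g w"
  using assms by (induction v) (auto simp: Pi_iff m_assoc word_value_closed)

lemma word_value_inverse_word:
  assumes "g \<in> UNIV \<rightarrow> carrier G"
  shows "word_value G g (inverse_word w) = inv (word_value G g w)"
proof (induction w)
  case Nil
  show ?case by (simp add: inverse_word_def)
next
  case (Cons a w)
  obtain i e where a: "a = (i, e)" by fastforce
  have gi: "g i \<in> carrier G" using assms by auto
  have "inverse_word (a # w) = inverse_word w @ [(i, \<not> e)]"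
    by (simp add: inverse_word_def a)
  then show ?case
    using gi word_value_closed[OF assms] Cons.IH
    by (simp add: word_value_append[OF assms] a inv_mult_group)
qed

text \<open>The commutator of \<open>w\<close> with a variable that does not occur in \<open>w\<close> is an identity, and it is
  freely reduced because that variable is new.\<close>

lemma satisfies_identity_if_central_values:
  assumes "freely_reduced w" and "w \<noteq> []"
    and central: "\<And>g x. \<lbrakk>g \<in> UNIV \<rightarrow> carrier G; x \<in> carrier G\<rbrakk>
      \<Longrightarrow> word_value G g w \<otimes> x = x \<otimes> word_value G g w"
  shows "satisfies_nontrivial_identity G"
proof -
  obtain m where m: "m \<notin> fst ` set w"
    using ex_new_if_finite[OF infinite_UNIV_nat, of "fst ` set w"] by auto
  let ?w' = "w @ [(m, True)] @ inverse_word w @ [(m, False)]"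
  have ne: "inverse_word w \<noteq> []"
    using \<open>w \<noteq> []\<close> by (simp add: inverse_word_def)
  have m': "m \<notin> fst ` set (inverse_word w)"
    using m by (force simp: inverse_word_def)
  have "fst (last w) \<noteq> m" "fst (hd (inverse_word w)) \<noteq> m" "fst (last (inverse_word w)) \<noteq> m"
    using m m' ne \<open>w \<noteq> []\<close> by (metis hd_in_set imageI last_in_set)+
  then have "freely_reduced ?w'"
    using assms(1) freely_reduced_inverse_word[OF assms(1)] ne
    unfolding freely_reduced_def by (auto simp: successively_append_iff successively_Cons)
  moreover have "word_value G g ?w' = \<one>" if g: "g \<in> UNIV \<rightarrow> carrier G" for g
  proof -
    have gm: "g m \<in> carrier G" using g by auto
    have wc: "word_value G g w \<in> carrier G" by (rule word_value_closed[OF g])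
    have "word_value G g ?w' = word_value G g w \<otimes> g m \<otimes> (inv (word_value G g w) \<otimes> inv (g m))"
      using gm wc by (simp add: word_value_append[OF g] word_value_inverse_word[OF g] m_assoc)
    also have "\<dots> = \<one>"
      using central[OF g gm] gm wc by (simp add: inv_mult_group[symmetric])
    finally show ?thesis .
  qed
  ultimately show ?thesis
    unfolding satisfies_nontrivial_identity_def by blast
qed

end

lemma (in group_hom) word_value_hom:
  assumes "g \<in> UNIV \<rightarrow> carrier G"
  shows "word_value H (\<lambda>i. h (g i)) w = h (word_value G g w)"
  using assms by (induction w) (auto simp: Pi_iff G.word_value_closed)

lemma identity_pullback:
  assumes "group X" and "group Y" and "f \<in> hom X Y" and "inj_on f (carrier X)"
    and "satisfies_nontrivial_identity Y"
  shows "satisfies_nontrivial_identity X"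
proof -
  interpret group_hom X Y f using assms(1-3) by (simp add: group_hom_def group_hom_axioms_def)
  obtain w where w: "freely_reduced w" "w \<noteq> []" "\<forall>g \<in> UNIV \<rightarrow> carrier Y. word_value Y g w = \<one>\<^bsub>Y\<^esub>"
    using assms(5) by (auto simp: satisfies_nontrivial_identity_def)
  have "word_value X g w = \<one>\<^bsub>X\<^esub>" if g: "g \<in> UNIV \<rightarrow> carrier X" for g
  proof -
    have "(\<lambda>i. f (g i)) \<in> UNIV \<rightarrow> carrier Y" using g hom_closed by (blast intro: Pi_I dest: funcset_mem)
    then have "f (word_value X g w) = \<one>\<^bsub>Y\<^esub>" using w(3) word_value_hom[OF g, of w] by metis
    then show ?thesis
      using assms(4) G.word_value_closed[OF g] by (metis G.one_closed hom_one inj_onD)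
  qed
  then show ?thesis using w by (auto simp: satisfies_nontrivial_identity_def)
qed

text \<open>An identity of the image of \<open>\<theta>\<close> takes its values on \<open>S\<close> in the kernel of \<open>\<theta>\<close>, hence in the
  centre of \<open>S\<close>.  With \<open>\<theta>\<close> the action on a normal subgroup by conjugation, this is how an identity
  of a group of automorphisms becomes an identity of the subgroup.\<close>

lemma identity_if_centralized:
  assumes "group G" and "group A" and \<theta>: "\<theta> \<in> hom G A"
    and ident: "satisfies_nontrivial_identity (A\<lparr>carrier := \<theta> ` carrier G\<rparr>)"
    and S: "subgroup S G"
    and ker: "\<And>a x. \<lbrakk>a \<in> carrier G; \<theta> a = \<one>\<^bsub>A\<^esub>; x \<in> S\<rbrakk> \<Longrightarrow> a \<otimes>\<^bsub>G\<^esub> x = x \<otimes>\<^bsub>G\<^esub> a"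
  shows "satisfies_nontrivial_identity (G\<lparr>carrier := S\<rparr>)"
proof -
  interpret G: group G by fact
  interpret A: group A by fact
  interpret \<theta>: group_hom G A \<theta> using \<theta> by unfold_locales
  interpret S: group "G\<lparr>carrier := S\<rparr>" by (rule G.subgroup_imp_group[OF S])
  interpret T: group "A\<lparr>carrier := \<theta> ` carrier G\<rparr>"
    by (rule A.subgroup_imp_group[OF \<theta>.img_is_subgroup])
  interpret i: group_hom "G\<lparr>carrier := S\<rparr>" G "\<lambda>x. x"
    by unfold_locales (use subgroup.mem_carrier[OF S] in \<open>auto simp: hom_def\<close>)
  interpret \<theta>': group_hom G "A\<lparr>carrier := \<theta> ` carrier G\<rparr>" \<theta>
    by unfold_locales (use \<theta> in \<open>auto simp: hom_def\<close>)
  obtain w where w: "freely_reduced w" "w \<noteq> []"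
    "\<And>g. g \<in> UNIV \<rightarrow> \<theta> ` carrier G \<Longrightarrow> word_value (A\<lparr>carrier := \<theta> ` carrier G\<rparr>) g w = \<one>\<^bsub>A\<^esub>"
    using ident by (auto simp: satisfies_nontrivial_identity_def)
  show ?thesis
  proof (rule S.satisfies_identity_if_central_values[OF w(1,2)])
    fix g :: "nat \<Rightarrow> _" and x
    assume g: "g \<in> UNIV \<rightarrow> carrier (G\<lparr>carrier := S\<rparr>)" and x: "x \<in> carrier (G\<lparr>carrier := S\<rparr>)"
    have gG: "g \<in> UNIV \<rightarrow> carrier G" using g subgroup.mem_carrier[OF S] by (auto simp: Pi_iff)
    have eq: "word_value (G\<lparr>carrier := S\<rparr>) g w = word_value G g w"
      using i.word_value_hom[OF g, of w] by simp
    have "\<theta> (word_value G g w) = \<one>\<^bsub>A\<^esub>"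
      using \<theta>'.word_value_hom[OF gG, of w] w(3)[of "\<lambda>i. \<theta> (g i)"] gG by (auto simp: Pi_iff)
    then show "word_value (G\<lparr>carrier := S\<rparr>) g w \<otimes>\<^bsub>G\<lparr>carrier := S\<rparr>\<^esub> x = x \<otimes>\<^bsub>G\<lparr>carrier := S\<rparr>\<^esub> word_value (G\<lparr>carrier := S\<rparr>) g w"
      using ker G.word_value_closed[OF gG] x unfolding eq by simp
  qed
qed

section \<open>Britton's lemma\<close>

locale hnn_data = group B for B :: "('b, 'm) monoid_scheme" (structure) +
  fixes H K :: "'b set" and \<phi> :: "'b \<Rightarrow> 'b"
  assumes subgroup_H: "subgroup H B" and subgroup_K: "subgroup K B"
    and iso_\<phi>: "\<phi> \<in> iso (B\<lparr>carrier := H\<rparr>) (B\<lparr>carrier := K\<rparr>)"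
begin

text \<open>The sign \<open>e\<close> stands for the letter \<open>t\<close> if it is true and for \<open>t\<inverse>\<close> otherwise.  An element \<open>x\<close>
  of \<open>assoc e\<close> can be moved to the left of the letter \<open>e\<close> at the price of becoming \<open>twist e x\<close>:
  this form of the defining relations is symmetric in \<open>t\<close> and \<open>t\<inverse>\<close>.\<close>

definition assoc :: "bool \<Rightarrow> 'b set" where
  "assoc e = (if e then K else H)"

definition twist :: "bool \<Rightarrow> 'b \<Rightarrow> 'b" where
  "twist e = (if e then inv_into H \<phi> else \<phi>)"

lemma subgroup_assoc: "subgroup (assoc e) B"
  by (simp add: assoc_def subgroup_H subgroup_K)

lemma assoc_closed: "x \<in> assoc e \<Longrightarrow> x \<in> carrier B"
  using subgroup.mem_carrier[OF subgroup_assoc] .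

lemma assoc_mult [simp]: "\<lbrakk>x \<in> assoc e; y \<in> assoc e\<rbrakk> \<Longrightarrow> x \<otimes> y \<in> assoc e"
  using subgroup.m_closed[OF subgroup_assoc] .

lemma assoc_inv [simp]: "x \<in> assoc e \<Longrightarrow> inv x \<in> assoc e"
  using subgroup.m_inv_closed[OF subgroup_assoc] .

lemma assoc_one [simp]: "\<one> \<in> assoc e"
  using subgroup.one_closed[OF subgroup_assoc] .

lemma assoc_mult_left_iff:
  assumes "h \<in> assoc e" and "b \<in> carrier B"
  shows "h \<otimes> b \<in> assoc e \<longleftrightarrow> b \<in> assoc e"
proof
  assume "h \<otimes> b \<in> assoc e"
  then have "inv h \<otimes> (h \<otimes> b) \<in> assoc e" using assms by simp
  then show "b \<in> assoc e" using assms by (simp add: assoc_closed m_assoc[symmetric])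
qed (use assms in simp)

lemma assoc_mult_right_iff:
  assumes "h \<in> assoc e" and "b \<in> carrier B"
  shows "b \<otimes> h \<in> assoc e \<longleftrightarrow> b \<in> assoc e"
proof
  assume "b \<otimes> h \<in> assoc e"
  then have "(b \<otimes> h) \<otimes> inv h \<in> assoc e" using assms by simp
  then show "b \<in> assoc e" using assms by (simp add: assoc_closed m_assoc)
qed (use assms in simp)

lemma bij_\<phi>: "bij_betw \<phi> H K"
  using iso_\<phi> by (simp add: iso_def)

lemma bij_twist: "bij_betw (twist e) (assoc e) (assoc (\<not> e))"
  using bij_\<phi> bij_betw_inv_into[OF bij_\<phi>] by (simp add: twist_def assoc_def)

lemma twist_closed [simp]: "x \<in> assoc e \<Longrightarrow> twist e x \<in> assoc (\<not> e)"
  using bij_betwE[OF bij_twist] by blast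

lemma twist_twist [simp]: "x \<in> assoc e \<Longrightarrow> twist (\<not> e) (twist e x) = x"
  using bij_\<phi> by (auto simp: twist_def assoc_def bij_betw_inv_into_left bij_betw_inv_into_right)

lemma twist_twist' [simp]: "x \<in> assoc (\<not> e) \<Longrightarrow> twist e (twist (\<not> e) x) = x"
  using twist_twist[of x "\<not> e"] by simp

lemma twist_False_mult:
  "\<lbrakk>x \<in> assoc False; y \<in> assoc False\<rbrakk> \<Longrightarrow> twist False (x \<otimes> y) = twist False x \<otimes> twist False y"
  using iso_\<phi> by (auto simp: iso_def hom_def twist_def assoc_def)

lemma twist_mult [simp]:
  assumes "x \<in> assoc e" "y \<in> assoc e"
  shows "twist e (x \<otimes> y) = twist e x \<otimes> twist e y"
proof (cases e)
  case False
  then show ?thesis using twist_False_mult assms by simp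
next
  case True
  have "twist False (twist True x \<otimes> twist True y) = x \<otimes> y"
    using assms twist_closed[of _ True] twist_twist[of _ True] True by (simp add: twist_False_mult)
  then show ?thesis
    using assms twist_closed[of _ True] twist_twist'[of "twist True x \<otimes> twist True y" True] True
    by simp
qed

lemma twist_one [simp]: "twist e \<one> = \<one>"
proof -
  have "twist e \<one> \<otimes> twist e \<one> = twist e \<one>"
    using twist_mult[of \<one> e \<one>] by simp
  moreover have "twist e \<one> \<in> carrier B"
    by (rule assoc_closed[OF twist_closed[OF assoc_one]])
  ultimately show ?thesis by simp
qed

text \<open>Van der Waerden's method: every element of the HNN-extension can be written as
  \<open>b e\<^sub>1 s\<^sub>1 \<dots> e\<^sub>n s\<^sub>n\<close> with letters \<open>e\<^sub>i\<close> and with \<open>s\<^sub>i\<close> in a transversal of the cosets of \<open>assoc e\<^sub>i\<close>.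
  Left multiplication by the generators is defined directly on such data, the defining relations
  are verified for it, and then different data are reached from the empty one by different
  elements.  The subgroup itself is represented by \<open>\<one>\<close>, so that cancellation of a letter is
  recognized by the value \<open>\<one>\<close>.\<close>

definition coset_rep :: "bool \<Rightarrow> 'b \<Rightarrow> 'b" where
  "coset_rep e b = (if b \<in> assoc e then \<one> else (SOME x. x \<in> assoc e #> b))"

lemma coset_rep_mem:
  assumes "b \<in> carrier B"
  shows "coset_rep e b \<in> assoc e #> b"
proof (cases "b \<in> assoc e")
  case True
  have "inv b \<otimes> b \<in> assoc e #> b"
    unfolding r_coset_def using assoc_inv[OF True] by blast
  then show ?thesis by (simp add: coset_rep_def True l_inv[OF assms])
next
  case False
  have "(SOME x. x \<in> assoc e #> b) \<in> assoc e #> b"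
    by (rule someI) (rule rcos_self[OF assms subgroup_assoc])
  then show ?thesis by (simp only: coset_rep_def False if_False)
qed

lemma coset_rep_closed [simp]: "b \<in> carrier B \<Longrightarrow> coset_rep e b \<in> carrier B"
  using coset_rep_mem[of b e] by (auto simp: r_coset_def assoc_closed)

lemma coset_rep_obtain:
  assumes "b \<in> carrier B"
  obtains h s where "h \<in> assoc e" and "s \<in> carrier B" and "coset_rep e b = s" and "b = h \<otimes> s"
proof -
  obtain k where k: "k \<in> assoc e" "coset_rep e b = k \<otimes> b"
    using coset_rep_mem[OF assms] by (auto simp: r_coset_def)
  have "b = inv k \<otimes> coset_rep e b"
    unfolding k(2) using assms k(1) by (simp add: assoc_closed m_assoc[symmetric])
  then show thesis
    by (rule that[OF assoc_inv[OF k(1)] coset_rep_closed[OF assms] HOL.refl])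
qed

lemma coset_rep_mult [simp]:
  assumes "h \<in> assoc e" and "b \<in> carrier B"
  shows "coset_rep e (h \<otimes> b) = coset_rep e b"
proof -
  have "assoc e #> (h \<otimes> b) = (assoc e #> h) #> b"
    using assms by (intro coset_mult_assoc[symmetric] subgroup.subset[OF subgroup_assoc]) (simp_all add: assoc_closed)
  also have "assoc e #> h = assoc e"
    using assms by (intro coset_join2 subgroup_assoc) (simp_all add: assoc_closed)
  finally have "assoc e #> (h \<otimes> b) = assoc e #> b" .
  then show ?thesis
    using assoc_mult_left_iff[OF assms] by (simp add: coset_rep_def)
qed

lemma coset_rep_idem:
  assumes "b \<in> carrier B"
  shows "coset_rep e (coset_rep e b) = coset_rep e b"
proof -
  obtain h s where hs: "h \<in> assoc e" "s \<in> carrier B" "coset_rep e b = s" "b = h \<otimes> s"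
    by (rule coset_rep_obtain[OF assms])
  have "coset_rep e s = coset_rep e b" unfolding hs(4) by (rule coset_rep_mult[OF hs(1,2), symmetric])
  then show ?thesis by (simp only: hs(3))
qed

lemma coset_rep_one_iff:
  assumes "b \<in> carrier B"
  shows "coset_rep e b = \<one> \<longleftrightarrow> b \<in> assoc e"
proof
  assume one: "coset_rep e b = \<one>"
  obtain h s where hs: "h \<in> assoc e" "coset_rep e b = s" "b = h \<otimes> s"
    by (rule coset_rep_obtain[OF assms])
  show "b \<in> assoc e" using hs(1) one hs(2) unfolding hs(3) by simp
qed (simp add: coset_rep_def)

definition normal_forms :: "('b \<times> (bool \<times> 'b) list) set" where
  "normal_forms = {(b, l). b \<in> carrier B
     \<and> (\<forall>(e, s) \<in> set l. s \<in> carrier B \<and> coset_rep e s = s)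
     \<and> successively (\<lambda>(e, s) (e', s'). \<not> (e' \<noteq> e \<and> s = \<one>)) l}"

text \<open>Left multiplication by the letter \<open>e\<close>: if \<open>b = h s\<close> with \<open>h \<in> assoc e\<close>, then \<open>e h s = (twist e h) e s\<close>,
  and the letter \<open>e\<close> is cancelled if \<open>s = \<one>\<close> and the inverse letter comes next.\<close>

fun push :: "bool \<Rightarrow> 'b \<times> (bool \<times> 'b) list \<Rightarrow> 'b \<times> (bool \<times> 'b) list" where
  "push e (b, l) =
    (let s = coset_rep e b; k = twist e (b \<otimes> inv s) in
      if s = \<one> \<and> l \<noteq> [] \<and> fst (hd l) \<noteq> e then (k \<otimes> snd (hd l), tl l) else (k, (e, s) # l))"

declare push.simps [simp del]

lemma push_mult:
  assumes "k \<in> assoc e" and "s \<in> carrier B" and "coset_rep e s = s"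
  shows push_cancel: "\<lbrakk>s = \<one>; l \<noteq> []; fst (hd l) \<noteq> e\<rbrakk>
      \<Longrightarrow> push e (k \<otimes> s, l) = (twist e k \<otimes> snd (hd l), tl l)"
    and push_no_cancel: "\<not> (s = \<one> \<and> l \<noteq> [] \<and> fst (hd l) \<noteq> e)
      \<Longrightarrow> push e (k \<otimes> s, l) = (twist e k, (e, s) # l)"
proof -
  have "coset_rep e (k \<otimes> s) = s" "k \<otimes> s \<otimes> inv s = k"
    using assms by (simp_all add: m_assoc assoc_closed)
  then have "push e (k \<otimes> s, l) =
      (if s = \<one> \<and> l \<noteq> [] \<and> fst (hd l) \<noteq> e then (twist e k \<otimes> snd (hd l), tl l)
       else (twist e k, (e, s) # l))"
    by (simp only: push.simps Let_def)
  then show "\<lbrakk>s = \<one>; l \<noteq> []; fst (hd l) \<noteq> e\<rbrakk>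
      \<Longrightarrow> push e (k \<otimes> s, l) = (twist e k \<otimes> snd (hd l), tl l)"
    and "\<not> (s = \<one> \<and> l \<noteq> [] \<and> fst (hd l) \<noteq> e) \<Longrightarrow> push e (k \<otimes> s, l) = (twist e k, (e, s) # l)"
    by (simp_all only: if_True if_False) simp
qed

lemma normal_form_decompose:
  assumes "st \<in> normal_forms"
  obtains k s l where "st = (k \<otimes> s, l)" "k \<in> assoc e" "s \<in> carrier B" "coset_rep e s = s"
proof -
  obtain b l where st: "st = (b, l)" "b \<in> carrier B" using assms by (auto simp: normal_forms_def)
  obtain k s where k: "k \<in> assoc e" "s \<in> carrier B" "coset_rep e b = s" "b = k \<otimes> s"
    using coset_rep_obtain[OF st(2)] by metis
  then have "coset_rep e s = s" using coset_rep_idem[OF st(2)] by metis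
  then show thesis using that[of k s l] st k by simp
qed

lemma normal_forms_Cons:
  "(b, (e, s) # l) \<in> normal_forms \<longleftrightarrow>
    b \<in> carrier B \<and> s \<in> carrier B \<and> coset_rep e s = s
    \<and> \<not> (s = \<one> \<and> l \<noteq> [] \<and> fst (hd l) \<noteq> e) \<and> (\<one>, l) \<in> normal_forms"
  by (cases l) (auto simp: normal_forms_def successively_Cons)

lemma normal_forms_base:
  "(b, l) \<in> normal_forms \<longleftrightarrow> b \<in> carrier B \<and> (\<one>, l) \<in> normal_forms"
  by (auto simp: normal_forms_def)

lemma push_closed:
  assumes "st \<in> normal_forms"
  shows "push e st \<in> normal_forms"
proof -
  obtain k s l where st: "st = (k \<otimes> s, l)" "k \<in> assoc e" "s \<in> carrier B" "coset_rep e s = s"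
    using normal_form_decompose[OF assms] by blast
  have l: "(\<one>, l) \<in> normal_forms" using assms st(1) normal_forms_base by blast
  have tk: "twist e k \<in> carrier B" using st(2) assoc_closed twist_closed by blast
  show ?thesis
  proof (cases "s = \<one> \<and> l \<noteq> [] \<and> fst (hd l) \<noteq> e")
    case True
    then obtain e' x l' where l': "l = (e', x) # l'" by (cases l) auto
    then have "x \<in> carrier B" "(\<one>, l') \<in> normal_forms" using l by (auto simp: normal_forms_Cons)
    then have "(twist e k \<otimes> x, l') \<in> normal_forms"
      using tk normal_forms_base[of "twist e k \<otimes> x" l'] by simp
    then show ?thesis using True l' push_cancel[OF st(2-4), of l] st(1) by simp
  next
    case False
    then have "(twist e k, (e, s) # l) \<in> normal_forms"
      using l tk st by (simp only: normal_forms_Cons) simp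
    then show ?thesis by (simp only: st(1) push_no_cancel[OF st(2-4) False])
  qed
qed

text \<open>If \<open>e\<close> cancels the first letter, then the letter after it cannot be cancelled by pushing
  \<open>\<not> e\<close>, because a normal form contains no cancelling pair; so the cancelled letter is restored.\<close>

lemma push_push:
  assumes "st \<in> normal_forms"
  shows "push (\<not> e) (push e st) = st"
proof -
  obtain k s l where st: "st = (k \<otimes> s, l)" "k \<in> assoc e" "s \<in> carrier B" "coset_rep e s = s"
    using normal_form_decompose[OF assms] by blast
  have tk: "twist e k \<in> assoc (\<not> e)" "twist e k \<in> carrier B"
    using st(2) assoc_closed twist_closed by blast+
  have l: "(\<one>, l) \<in> normal_forms" using assms st(1) normal_forms_base by blast
  show ?thesis
  proof (cases "s = \<one> \<and> l \<noteq> [] \<and> fst (hd l) \<noteq> e")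
    case True
    then obtain x l' where l': "l = (\<not> e, x) # l'" by (cases l) auto
    have x: "x \<in> carrier B" "coset_rep (\<not> e) x = x" "\<not> (x = \<one> \<and> l' \<noteq> [] \<and> fst (hd l') \<noteq> (\<not> e))"
      using l unfolding l' normal_forms_Cons by blast+
    have "push e st = (twist e k \<otimes> x, l')"
      using True l' push_cancel[OF st(2-4), of l] st(1) by simp
    also have "push (\<not> e) \<dots> = (twist (\<not> e) (twist e k), (\<not> e, x) # l')"
      by (rule push_no_cancel[OF tk(1) x])
    finally show ?thesis using st True l' by (simp add: assoc_closed)
  next
    case False
    then have "push e st = (twist e k \<otimes> \<one>, (e, s) # l)"
      using tk by (simp add: st(1) push_no_cancel[OF st(2-4)])
    also have "push (\<not> e) \<dots> = (twist (\<not> e) (twist e k) \<otimes> s, l)"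
      by (subst push_cancel[OF tk(1)]) (simp_all add: coset_rep_def)
    finally show ?thesis using st by simp
  qed
qed

lemma push_twist:
  assumes "(b, l) \<in> normal_forms" and "h \<in> assoc e" and "push e (b, l) = (c, m)"
  shows "push e (h \<otimes> b, l) = (twist e h \<otimes> c, m)"
proof -
  obtain k s where st: "b = k \<otimes> s" "k \<in> assoc e" "s \<in> carrier B" "coset_rep e s = s"
    using normal_form_decompose[OF assms(1)] by (metis prod.inject)
  have l: "(\<one>, l) \<in> normal_forms" using assms(1) normal_forms_base by blast
  then have x: "snd (hd l) \<in> carrier B" if "l \<noteq> []"
    using that by (cases l) (auto simp: normal_forms_Cons)
  have tc: "twist e k \<in> carrier B" "twist e h \<in> carrier B"
    using st(2) assms(2) assoc_closed twist_closed by blast+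
  have hb: "h \<otimes> b = (h \<otimes> k) \<otimes> s" using st assms(2) by (simp add: m_assoc assoc_closed)
  have hk: "h \<otimes> k \<in> assoc e" using st assms(2) by simp
  show ?thesis
  proof (cases "s = \<one> \<and> l \<noteq> [] \<and> fst (hd l) \<noteq> e")
    case True
    have "(c, m) = (twist e k \<otimes> snd (hd l), tl l)"
      using assms(3) push_cancel[OF st(2-4), of l] True st(1) by metis
    moreover have "push e (h \<otimes> b, l) = (twist e (h \<otimes> k) \<otimes> snd (hd l), tl l)"
      using push_cancel[OF hk st(3,4), of l] True hb by metis
    ultimately show ?thesis
      using x tc True by (simp add: twist_mult[OF assms(2) st(2)] m_assoc)
  next
    case False
    have "(c, m) = (twist e k, (e, s) # l)"
      using assms(3) push_no_cancel[OF st(2-4) False] st(1) by metis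
    moreover have "push e (h \<otimes> b, l) = (twist e (h \<otimes> k), (e, s) # l)"
      using push_no_cancel[OF hk st(3,4) False] hb by metis
    ultimately show ?thesis
      by (simp add: twist_mult[OF assms(2) st(2)])
  qed
qed

fun act_letter :: "'b hnn_letter \<Rightarrow> 'b \<times> (bool \<times> 'b) list \<Rightarrow> 'b \<times> (bool \<times> 'b) list" where
  "act_letter (Base a) (b, l) = (a \<otimes> b, l)"
| "act_letter Stable st = push True st"
| "act_letter StableInv st = push False st"

definition act :: "'b hnn_letter list \<Rightarrow> 'b \<times> (bool \<times> 'b) list \<Rightarrow> 'b \<times> (bool \<times> 'b) list" where
  "act u st = foldr act_letter u st"

lemma act_Nil [simp]: "act [] st = st"
  and act_Cons [simp]: "act (x # u) st = act_letter x (act u st)"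
  and act_append [simp]: "act (u @ v) st = act u (act v st)"
  by (simp_all add: act_def)

lemma hnn_words_simps [simp]:
  "[] \<in> hnn_words B"
  "x # u \<in> hnn_words B \<longleftrightarrow> x \<in> Base ` carrier B \<union> {Stable, StableInv} \<and> u \<in> hnn_words B"
  "u @ v \<in> hnn_words B \<longleftrightarrow> u \<in> hnn_words B \<and> v \<in> hnn_words B"
  by (auto simp: hnn_words_def)

lemma act_closed:
  assumes "u \<in> hnn_words B" and "st \<in> normal_forms"
  shows "act u st \<in> normal_forms"
  using assms(1)
proof (induction u)
  case (Cons x u)
  then have IH: "act u st \<in> normal_forms" by simp
  obtain b l where bl: "act u st = (b, l)" by fastforce
  have "(a \<otimes> b, l) \<in> normal_forms" if "a \<in> carrier B" for a
    using IH that unfolding bl normal_forms_def by simp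
  then show ?case
    using Cons.prems IH push_closed bl by auto
qed (use assms(2) in simp)

lemma in_H: "h \<in> H \<Longrightarrow> h \<in> assoc False"
  by (simp add: assoc_def)

lemma hnn_eq_words:
  assumes "hnn_eq B H \<phi> u v"
  shows "u \<in> hnn_words B \<and> v \<in> hnn_words B"
  using assms
proof induction
  case (conj h)
  have "h \<in> carrier B" "twist False h \<in> carrier B"
    using assoc_closed[OF in_H[OF conj]] assoc_closed[OF twist_closed[OF in_H[OF conj]]] .
  then show ?case by (auto simp: twist_def)
qed auto

text \<open>The cancellation of letters is \<open>push_push\<close>, and the relation \<open>t\<inverse> h t = h\<phi>\<close> follows from it because
  multiplication by \<open>h\<close> passes through \<open>push\<close> as multiplication by the twisted element.\<close>

lemma act_hnn_eq:
  assumes "hnn_eq B H \<phi> u v" and "st \<in> normal_forms"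
  shows "act u st = act v st"
  using assms
proof (induction arbitrary: st)
  case base_one
  then show ?case by (cases st) (auto simp: normal_forms_def)
next
  case (base_mult a b)
  then show ?case by (cases st) (auto simp: normal_forms_def m_assoc)
next
  case stable_inv
  then show ?case using push_push[of st False] by simp
next
  case inv_stable
  then show ?case using push_push[of st True] by simp
next
  case (conj h)
  obtain b l where st: "st = (b, l)" by fastforce
  obtain c m where cm: "push True st = (c, m)" by fastforce
  have "push False (c, m) = (b, l)" "(c, m) \<in> normal_forms"
    using push_push[OF conj(2), of True] push_closed[OF conj(2), of True] cm st by simp_all
  then have "push False (h \<otimes> c, m) = (twist False h \<otimes> b, l)"
    by (intro push_twist in_H conj(1))
  then show ?case using cm st by (simp add: twist_def)
next
  case (cong u v x y)
  then show ?case using act_closed[of y st] by simp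
qed auto

definition letter_word :: "bool \<Rightarrow> 'b hnn_letter" where
  "letter_word e = (if e then Stable else StableInv)"

lemma act_letter_word [simp]: "act_letter (letter_word e) st = push e st"
  by (simp add: letter_word_def)

fun path_word :: "(bool \<times> 'b) list \<Rightarrow> 'b hnn_letter list" where
  "path_word [] = []"
| "path_word ((e, x) # l) = letter_word e # Base x # path_word l"

text \<open>The pair \<open>(e, x)\<close> stands for the product of the letter \<open>e\<close> and the base element \<open>x\<close>; a list is
  reduced if no such element \<open>x\<close> can be moved across its letter to meet the inverse letter.\<close>

definition reduced :: "(bool \<times> 'b) list \<Rightarrow> bool" where
  "reduced l \<longleftrightarrow> snd ` set l \<subseteq> carrier B
     \<and> successively (\<lambda>(e, x) (e', y). \<not> (e' \<noteq> e \<and> x \<in> assoc e)) l"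

text \<open>After a letter \<open>e\<close> has been pushed, the base part lies in \<open>assoc (\<not> e)\<close>.  Multiplying by the
  next base element of a reduced list therefore leaves the subgroup in question whenever the next
  letter is opposite, and no letter is ever cancelled.\<close>

lemma act_reduced:
  assumes "reduced l" and "l \<noteq> []"
  shows "\<exists>b m. act (path_word l) (\<one>, []) = (b, m) \<and> b \<in> assoc (\<not> fst (hd l))
    \<and> m \<noteq> [] \<and> fst (hd m) = fst (hd l)"
  using assms
proof (induction l)
  case (Cons a l)
  obtain e x where a: "a = (e, x)" by fastforce
  have x: "x \<in> carrier B" using Cons.prems a by (auto simp: reduced_def)
  obtain b m where bm: "act (path_word l) (\<one>, []) = (b, m)" by fastforce
  have b: "b \<in> carrier B"
    and no_cancel: "\<not> (x \<otimes> b \<in> assoc e \<and> m \<noteq> [] \<and> fst (hd m) \<noteq> e)"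
  proof -
    have "b \<in> carrier B \<and> \<not> (x \<otimes> b \<in> assoc e \<and> m \<noteq> [] \<and> fst (hd m) \<noteq> e)"
    proof (cases "l = []")
      case False
      then have red: "reduced l" "fst (hd l) \<noteq> e \<Longrightarrow> x \<notin> assoc e"
        using Cons.prems a by (auto simp: reduced_def successively_Cons split: prod.splits)
      then have IH: "b \<in> assoc (\<not> fst (hd l))" "fst (hd m) = fst (hd l)"
        using Cons.IH False bm by auto
      have "x \<otimes> b \<notin> assoc e" if "fst (hd l) \<noteq> e"
      proof -
        have "b \<in> assoc e" using IH(1) that by (cases e) auto
        then show ?thesis using red(2)[OF that] assoc_mult_right_iff[OF _ x] by blast
      qed
      then show ?thesis using IH assoc_closed[OF IH(1)] by auto
    qed (use bm in auto)
    then show "b \<in> carrier B" "\<not> (x \<otimes> b \<in> assoc e \<and> m \<noteq> [] \<and> fst (hd m) \<noteq> e)" by blast+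
  qed
  have xb: "x \<otimes> b \<in> carrier B" using x b by simp
  obtain k s where ks: "k \<in> assoc e" "s \<in> carrier B" "coset_rep e (x \<otimes> b) = s" "x \<otimes> b = k \<otimes> s"
    by (rule coset_rep_obtain[OF xb])
  have s: "coset_rep e s = s" using coset_rep_idem[OF xb, of e] unfolding ks(3) .
  have "\<not> (s = \<one> \<and> m \<noteq> [] \<and> fst (hd m) \<noteq> e)"
    using no_cancel coset_rep_one_iff[OF xb, of e] ks(3) by simp
  then have "push e (x \<otimes> b, m) = (twist e k, (e, s) # m)"
    unfolding ks(4) by (rule push_no_cancel[OF ks(1,2) s])
  then show ?case
    using bm twist_closed[OF ks(1)] by (simp add: a)
qed simp

abbreviation E :: "'b hnn_letter list set monoid" where
  "E \<equiv> HNN B H \<phi>"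

definition word_class :: "'b hnn_letter list \<Rightarrow> 'b hnn_letter list set" where
  "word_class u = hnn_rel B H \<phi> `` {u}"

lemma word_class_eq_iff:
  assumes "u \<in> hnn_words B" and "v \<in> hnn_words B"
  shows "word_class u = word_class v \<longleftrightarrow> hnn_eq B H \<phi> u v"
  using assms by (auto simp: word_class_def hnn_rel_def intro: hnn_eq.refl hnn_eq.sym hnn_eq.trans)

lemma carrier_E: "carrier E = word_class ` hnn_words B"
  by (auto simp: HNN_def quotient_def word_class_def)

lemma one_E: "\<one>\<^bsub>E\<^esub> = word_class []"
  by (simp add: HNN_def word_class_def)

lemma mult_E:
  assumes "u \<in> hnn_words B" and "v \<in> hnn_words B"
  shows "word_class u \<otimes>\<^bsub>E\<^esub> word_class v = word_class (u @ v)"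
proof -
  have "hnn_eq B H \<phi> (u @ v) w"
    if uv: "hnn_eq B H \<phi> u u'" "hnn_eq B H \<phi> v v'" and w: "hnn_eq B H \<phi> (u' @ v') w" for u' v' w
  proof -
    have "hnn_eq B H \<phi> (u @ v) (u' @ v)"
      using hnn_eq.cong[OF uv(1), of "[]" v] assms by simp
    moreover have "hnn_eq B H \<phi> (u' @ v) (u' @ v')"
      using hnn_eq.cong[OF uv(2), of u' "[]"] hnn_eq_words[OF uv(1)] by simp
    ultimately show ?thesis using w by (blast intro: hnn_eq.trans)
  qed
  then have "hnn_rel B H \<phi> `` {u' @ v' | u' v'. u' \<in> word_class u \<and> v' \<in> word_class v}
      = word_class (u @ v)"
    using assms by (auto simp: word_class_def hnn_rel_def intro: hnn_eq.refl)
  then show ?thesis by (simp add: HNN_def)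
qed

lemma letter_cancel: "hnn_eq B H \<phi> [letter_word e, letter_word (\<not> e)] []"
  by (cases e) (simp_all add: letter_word_def hnn_eq.intros)

lemma group_E: "group E"
proof (rule groupI)
  fix x assume "x \<in> carrier E"
  then obtain u where u: "u \<in> hnn_words B" "x = word_class u" by (auto simp: carrier_E)
  have "\<exists>v \<in> hnn_words B. word_class (v @ u) = word_class []"
    using u(1)
  proof (induction u)
    case (Cons a u)
    then obtain v where v: "v \<in> hnn_words B" "word_class (v @ u) = word_class []" by auto
    have "\<exists>b. [b] \<in> hnn_words B \<and> hnn_eq B H \<phi> [b, a] []"
    proof -
      consider c where "a = Base c" "c \<in> carrier B" | e where "a = letter_word e"
        using Cons.prems by (force simp: letter_word_def)
      then show ?thesis
      proof cases
        case 1
        have "hnn_eq B H \<phi> [Base (inv c), Base c] [Base (inv c \<otimes> c)]"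
          using 1 by (intro hnn_eq.base_mult) simp_all
        then have "hnn_eq B H \<phi> [Base (inv c), Base c] []"
          using 1 hnn_eq.base_one[of B H \<phi>] by (simp add: hnn_eq.trans)
        then show ?thesis using 1 by (intro exI[of _ "Base (inv c)"]) simp
      next
        case 2
        then show ?thesis
          using letter_cancel[of "\<not> e"] by (intro exI[of _ "letter_word (\<not> e)"]) (simp add: letter_word_def)
      qed
    qed
    then obtain b where b: "[b] \<in> hnn_words B" "hnn_eq B H \<phi> [b, a] []" by blast
    have "hnn_eq B H \<phi> (v @ [b, a] @ u) (v @ [] @ u)"
      using v(1) b Cons.prems by (intro hnn_eq.cong) simp_all
    then have "word_class ((v @ [b]) @ a # u) = word_class (v @ u)"
      using v(1) b Cons.prems by (subst word_class_eq_iff) simp_all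
    then show ?case using v b by (intro bexI[of _ "v @ [b]"]) simp_all
  qed (auto intro: bexI[of _ "[]"])
  then show "\<exists>y \<in> carrier E. y \<otimes>\<^bsub>E\<^esub> x = \<one>\<^bsub>E\<^esub>"
    using u by (auto simp: carrier_E one_E mult_E)
qed (auto simp: carrier_E one_E mult_E)

definition base :: "'b \<Rightarrow> 'b hnn_letter list set" where
  "base b = word_class [Base b]"

definition letter :: "bool \<Rightarrow> 'b hnn_letter list set" where
  "letter e = word_class [letter_word e]"

lemma base_hom: "base \<in> hom B E"
  by (rule homI) (auto simp: base_def carrier_E mult_E word_class_eq_iff hnn_eq.sym[OF hnn_eq.base_mult])

lemma letter_closed: "letter e \<in> carrier E"
  by (auto simp: letter_def carrier_E letter_word_def)

lemma letter_letter: "letter e \<otimes>\<^bsub>E\<^esub> letter (\<not> e) = \<one>\<^bsub>E\<^esub>"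
  using letter_cancel[of e]
  by (cases e) (simp_all add: letter_def mult_E one_E word_class_eq_iff letter_word_def)

lemma letter_conj_False:
  assumes "x \<in> assoc False"
  shows "letter False \<otimes>\<^bsub>E\<^esub> base x \<otimes>\<^bsub>E\<^esub> letter True = base (twist False x)"
proof -
  have "x \<in> carrier B" "twist False x \<in> carrier B"
    using assoc_closed[OF assms] assoc_closed[OF twist_closed[OF assms]] .
  moreover have "hnn_eq B H \<phi> [StableInv, Base x, Stable] [Base (twist False x)]"
    using hnn_eq.conj[of x H B \<phi>] assms by (simp add: assoc_def twist_def)
  ultimately show ?thesis
    by (simp add: letter_def base_def mult_E word_class_eq_iff letter_word_def)
qed

fun path :: "(bool \<times> 'b) list \<Rightarrow> 'b hnn_letter list set" where
  "path [] = \<one>\<^bsub>E\<^esub>"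
| "path ((e, x) # l) = letter e \<otimes>\<^bsub>E\<^esub> (base x \<otimes>\<^bsub>E\<^esub> path l)"

lemma path_word_closed: "snd ` set l \<subseteq> carrier B \<Longrightarrow> path_word l \<in> hnn_words B"
  by (induction l rule: path_word.induct) (auto simp: letter_word_def)

lemma path_eq_word_class: "snd ` set l \<subseteq> carrier B \<Longrightarrow> path l = word_class (path_word l)"
proof (induction l rule: path_word.induct)
  case (2 e x l)
  then show ?case using path_word_closed[of l]
    by (simp add: letter_def base_def mult_E letter_word_def)
qed (simp add: one_E)

theorem britton:
  assumes "reduced l" and "l \<noteq> []"
  shows "path l \<noteq> \<one>\<^bsub>E\<^esub>"
proof
  assume one: "path l = \<one>\<^bsub>E\<^esub>"
  have l: "snd ` set l \<subseteq> carrier B" using assms(1) by (simp add: reduced_def)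
  have "hnn_eq B H \<phi> (path_word l) []"
    using one path_word_closed[OF l] by (simp add: path_eq_word_class[OF l] one_E word_class_eq_iff)
  moreover have "(\<one>, []) \<in> normal_forms" by (simp add: normal_forms_def)
  ultimately have "act (path_word l) (\<one>, []) = (\<one>, [])" using act_hnn_eq by fastforce
  then show False using act_reduced[OF assms] by auto
qed

end

section \<open>Separation by groups of a class\<close>

text \<open>The elements of \<open>G\<close> that no quotient in \<open>\<C>\<close> separates from \<open>S\<close>.\<close>

definition pro_closure :: "('u monoid \<Rightarrow> bool) \<Rightarrow> ('a, 'm) monoid_scheme \<Rightarrow> 'a set \<Rightarrow> 'a set" where
  "pro_closure \<C> G S = {x \<in> carrier G. \<forall>X f. \<C> X \<longrightarrow> f \<in> epi G X \<longrightarrow> f x \<in> f ` S}"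

lemma pro_closureE:
  assumes "x \<in> pro_closure \<C> G S" and "\<C> X" and "f \<in> epi G X"
  obtains s where "s \<in> S" and "f x = f s"
  using assms unfolding pro_closure_def by blast

lemma group_class_group: "\<lbrakk>group_class \<C>; \<C> X\<rbrakk> \<Longrightarrow> group X"
  by (simp add: group_class_def)

lemma epi_group_hom:
  assumes "group_class \<C>" "\<C> X" "group G" "f \<in> epi G X"
  shows "group_hom G X f"
  using assms by (simp add: group_hom_def group_hom_axioms_def group_class_group epi_iff_subset)

lemma residually_eqI:
  assumes "group_class \<C>" and "residually \<C> G" and "group G"
    and xy: "x \<in> carrier G" "y \<in> carrier G"
    and eq: "\<And>X f. \<lbrakk>\<C> X; f \<in> epi G X; group_hom G X f\<rbrakk> \<Longrightarrow> f x = f y"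
  shows "x = y"
proof (rule ccontr)
  interpret group G by fact
  assume "x \<noteq> y"
  then have "x \<otimes>\<^bsub>G\<^esub> inv\<^bsub>G\<^esub> y \<noteq> \<one>\<^bsub>G\<^esub>"
    using xy by (metis inv_closed inv_equality inv_inv)
  moreover have "x \<otimes>\<^bsub>G\<^esub> inv\<^bsub>G\<^esub> y \<in> carrier G" using xy by simp
  ultimately obtain X f where X: "\<C> X" "f \<in> epi G X" "f (x \<otimes>\<^bsub>G\<^esub> inv\<^bsub>G\<^esub> y) \<noteq> \<one>\<^bsub>X\<^esub>"
    using assms(2) by (auto simp: residually_def)
  interpret group_hom G X f using epi_group_hom assms(1,3) X by blast
  have "f x = f y" using eq X group_hom_axioms by blast
  then show False using X(3) xy by simp
qed

text \<open>In a residually \<open>\<C>\<close> group a failing equation fails in some quotient in \<open>\<C>\<close>; there the elements of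
  the closure may be replaced by elements of \<open>S\<close>.\<close>

lemma pro_closure_commute:
  assumes "group_class \<C>" and "residually \<C> G" and "group G"
    and "S \<subseteq> carrier G" and "x \<in> pro_closure \<C> G S" and "y \<in> carrier G"
    and comm: "\<And>s. s \<in> S \<Longrightarrow> y \<otimes>\<^bsub>G\<^esub> s = s \<otimes>\<^bsub>G\<^esub> y"
  shows "y \<otimes>\<^bsub>G\<^esub> x = x \<otimes>\<^bsub>G\<^esub> y"
proof (rule residually_eqI[OF assms(1-3)])
  interpret group G by fact
  have x: "x \<in> carrier G" using assms(5) by (simp add: pro_closure_def)
  then show "y \<otimes>\<^bsub>G\<^esub> x \<in> carrier G" "x \<otimes>\<^bsub>G\<^esub> y \<in> carrier G" using assms(6) by simp_all
  fix X f assume X: "\<C> X" "f \<in> epi G X" "group_hom G X f"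
  interpret group_hom G X f by fact
  obtain s where s: "s \<in> S" "f x = f s" using pro_closureE[OF assms(5) X(1,2)] .
  have "f (y \<otimes>\<^bsub>G\<^esub> s) = f (s \<otimes>\<^bsub>G\<^esub> y)" using comm[OF s(1)] by simp
  then show "f (y \<otimes>\<^bsub>G\<^esub> x) = f (x \<otimes>\<^bsub>G\<^esub> y)"
    using s x assms(4,6) by auto
qed

lemma pro_closure_word_value:
  assumes "group_class \<C>" and "residually \<C> G" and "group G"
    and "S \<subseteq> carrier G" and g: "g \<in> UNIV \<rightarrow> pro_closure \<C> G S"
    and w: "\<And>h. h \<in> UNIV \<rightarrow> S \<Longrightarrow> word_value G h w = \<one>\<^bsub>G\<^esub>"
  shows "word_value G g w = \<one>\<^bsub>G\<^esub>"
proof (rule residually_eqI[OF assms(1-3)])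
  interpret group G by fact
  have gG: "g \<in> UNIV \<rightarrow> carrier G" using g by (auto simp: pro_closure_def)
  then show "word_value G g w \<in> carrier G" by (rule word_value_closed)
  fix X f assume X: "\<C> X" "f \<in> epi G X" "group_hom G X f"
  interpret group_hom G X f by fact
  have "\<forall>i. \<exists>s \<in> S. f (g i) = f s" using g X pro_closureE by (metis PiE UNIV_I)
  then obtain h where h: "\<And>i. h i \<in> S" "\<And>i. f (g i) = f (h i)" by metis
  then have hS: "h \<in> UNIV \<rightarrow> S" "h \<in> UNIV \<rightarrow> carrier G" using assms(4) by auto
  have "f (word_value G g w) = word_value X (\<lambda>i. f (h i)) w"
    using word_value_hom[OF gG] h(2) by simp
  also have "\<dots> = f (word_value G h w)" using word_value_hom[OF hS(2)] by simp
  finally show "f (word_value G g w) = f \<one>\<^bsub>G\<^esub>" using w[OF hS(1)] by simp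
qed (simp add: group.is_monoid[OF assms(3)] monoid.one_closed)

lemma pro_closure_mult:
  assumes "group_class \<C>" and "group G" and S: "subgroup S G"
    and x: "x \<in> pro_closure \<C> G S" and y: "y \<in> pro_closure \<C> G S"
  shows "x \<otimes>\<^bsub>G\<^esub> y \<in> pro_closure \<C> G S"
proof -
  interpret group G by fact
  have xy: "x \<in> carrier G" "y \<in> carrier G" using x y by (auto simp: pro_closure_def)
  have "f (x \<otimes>\<^bsub>G\<^esub> y) \<in> f ` S" if X: "\<C> X" "f \<in> epi G X" for X f
  proof -
    interpret group_hom G X f using epi_group_hom assms(1,2) X by blast
    obtain s where s: "s \<in> S" "f x = f s" using pro_closureE[OF x X] .
    obtain r where r: "r \<in> S" "f y = f r" using pro_closureE[OF y X] .
    have "f (x \<otimes>\<^bsub>G\<^esub> y) = f (s \<otimes>\<^bsub>G\<^esub> r)" "s \<otimes>\<^bsub>G\<^esub> r \<in> S"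
      using s r xy subgroup.mem_carrier[OF S] subgroup.m_closed[OF S] by simp_all
    then show ?thesis by blast
  qed
  then show ?thesis using xy by (simp add: pro_closure_def)
qed

lemma pro_closure_conj:
  assumes "group_class \<C>" and "group G" and S: "S \<subseteq> carrier G"
    and x: "x \<in> pro_closure \<C> G S" and y: "y \<in> carrier G"
    and conj: "\<And>s. s \<in> S \<Longrightarrow> y \<otimes>\<^bsub>G\<^esub> s \<otimes>\<^bsub>G\<^esub> inv\<^bsub>G\<^esub> y \<in> S"
  shows "y \<otimes>\<^bsub>G\<^esub> x \<otimes>\<^bsub>G\<^esub> inv\<^bsub>G\<^esub> y \<in> pro_closure \<C> G S"
proof -
  interpret group G by fact
  have xG: "x \<in> carrier G" using x by (auto simp: pro_closure_def)
  have "f (y \<otimes>\<^bsub>G\<^esub> x \<otimes>\<^bsub>G\<^esub> inv\<^bsub>G\<^esub> y) \<in> f ` S" if X: "\<C> X" "f \<in> epi G X" for X f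
  proof -
    interpret group_hom G X f using epi_group_hom assms(1,2) X by blast
    obtain s where s: "s \<in> S" "f x = f s" using pro_closureE[OF x X] .
    then have "f (y \<otimes>\<^bsub>G\<^esub> x \<otimes>\<^bsub>G\<^esub> inv\<^bsub>G\<^esub> y) = f (y \<otimes>\<^bsub>G\<^esub> s \<otimes>\<^bsub>G\<^esub> inv\<^bsub>G\<^esub> y)"
      using xG y subsetD[OF S s(1)] by simp
    then show ?thesis using conj[OF s(1)] by simp
  qed
  then show ?thesis using xG y by (simp add: pro_closure_def)
qed

lemma in_class_epi:
  assumes "quotient_closed \<C>" and C: "group_class \<C>" and "in_class \<C> X" and "group Y" and "f \<in> epi X Y"
  shows "in_class \<C> Y"
proof -
  obtain X1 h where X1: "\<C> X1" "h \<in> iso X1 X"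
    using assms(3) by (auto simp: in_class_def is_iso_def)
  have epi: "f \<circ> h \<in> epi X1 Y"
    using X1(2) assms(5) epi_compose iso_iff_mon_epi by metis
  interpret group_hom X1 Y "f \<circ> h"
    using epi group_class_group[OF C X1(1)] assms(4) by (simp add: group_hom_def group_hom_axioms_def epi_iff_subset)
  have iso: "X1 Mod (kernel X1 Y (f \<circ> h)) \<cong> Y"
    using epi by (intro FactGroup_iso) (simp add: epi_def)
  have "in_class \<C> (X1 Mod (kernel X1 Y (f \<circ> h)))"
    using assms(1) X1(1) normal_kernel by (auto simp: quotient_closed_def)
  then obtain X2 where "\<C> X2" "X2 \<cong> X1 Mod (kernel X1 Y (f \<circ> h))" by (auto simp: in_class_def)
  then have "\<C> X2" "X2 \<cong> Y" using iso iso_trans by blast+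
  then show ?thesis using assms(4) by (auto simp: in_class_def)
qed

text \<open>The image of \<open>G\<close> in \<open>X\<close> belongs to the class, and so does its quotient by the image of \<open>N\<close>.\<close>

lemma separating_quotient:
  assumes C: "group_class \<C>" "subgroup_closed \<C>" "quotient_closed \<C>"
    and "\<C> X" and "group G" and "g \<in> hom G X" and N: "N \<lhd> G"
    and x: "x \<in> carrier G" "g x \<notin> g ` N"
  shows "\<exists>Y f. \<C> Y \<and> f \<in> epi G Y \<and> (\<forall>n \<in> N. f n = \<one>\<^bsub>Y\<^esub>) \<and> f x \<noteq> \<one>\<^bsub>Y\<^esub>"
proof -
  interpret N: normal N G by fact
  interpret G: group G by fact
  interpret X: group X using group_class_group C(1) assms(4) by blast
  interpret gX: group_hom G X g using assms(6) by unfold_locales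
  define S where "S = X\<lparr>carrier := g ` carrier G\<rparr>"
  have sub: "subgroup (g ` carrier G) X" by (rule gX.img_is_subgroup)
  interpret S: group S unfolding S_def by (rule X.subgroup_imp_group[OF sub])
  have S_class: "in_class \<C> S"
    using C(2) assms(4) sub by (simp add: subgroup_closed_def S_def)
  interpret gS: group_hom G S g
    by unfold_locales (auto simp: hom_def S_def)
  have "g ` N \<lhd> S"
    unfolding S.normal_inv_iff
  proof (intro conjI ballI)
    show "subgroup (g ` N) S" by (rule gS.subgroup_img_is_subgroup) (rule N.subgroup_axioms)
    fix u v assume "u \<in> carrier S" "v \<in> g ` N"
    then obtain a n where a: "a \<in> carrier G" "u = g a" and n: "n \<in> N" "v = g n"
      by (auto simp: S_def)
    have "u \<otimes>\<^bsub>S\<^esub> v \<otimes>\<^bsub>S\<^esub> inv\<^bsub>S\<^esub> u = g (a \<otimes>\<^bsub>G\<^esub> n \<otimes>\<^bsub>G\<^esub> inv\<^bsub>G\<^esub> a)"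
      by (simp only: a n(2) N.mem_carrier[OF n(1)] gS.hom_mult gS.hom_inv N.m_closed N.inv_closed)
    then show "u \<otimes>\<^bsub>S\<^esub> v \<otimes>\<^bsub>S\<^esub> inv\<^bsub>S\<^esub> u \<in> g ` N"
      using N.inv_op_closed2[OF a(1) n(1)] by simp
  qed
  then interpret gN: normal "g ` N" S .
  have epi: "(\<lambda>a. g ` N #>\<^bsub>S\<^esub> a) \<in> epi S (S Mod g ` N)"
    using gN.r_coset_hom_Mod by (auto simp: epi_iff_subset carrier_FactGroup)
  have "in_class \<C> (S Mod g ` N)"
    by (rule in_class_epi[OF C(3,1) S_class gN.factorgroup_is_group epi])
  then obtain Y where Y: "\<C> Y" "Y \<cong> S Mod g ` N" by (auto simp: in_class_def)
  interpret Y: group Y using group_class_group C(1) Y(1) by blast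
  obtain j where j: "j \<in> iso (S Mod g ` N) Y"
    using Y(2) Y.iso_sym by (auto simp: is_iso_def)
  interpret j: group_hom "S Mod g ` N" Y j
    by (intro group_hom.intro gN.factorgroup_is_group Y.is_group group_hom_axioms.intro)
      (use j in \<open>simp add: iso_def\<close>)
  define f where "f = j \<circ> (\<lambda>a. g ` N #>\<^bsub>S\<^esub> a) \<circ> g"
  have "g \<in> epi G S" using gS.homh by (auto simp: epi_iff_subset S_def)
  then have f_epi: "f \<in> epi G Y"
    unfolding f_def using j epi by (intro epi_compose) (auto simp: iso_iff_mon_epi)
  have f_one: "f a = \<one>\<^bsub>Y\<^esub> \<longleftrightarrow> g a \<in> g ` N" if a: "a \<in> carrier G" for a
  proof -
    have ga: "g a \<in> carrier S" using gS.hom_closed a by blast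
    have "f a = \<one>\<^bsub>Y\<^esub> \<longleftrightarrow> g ` N #>\<^bsub>S\<^esub> g a = g ` N"
    proof
      assume "f a = \<one>\<^bsub>Y\<^esub>"
      then have "j (g ` N #>\<^bsub>S\<^esub> g a) = j \<one>\<^bsub>S Mod g ` N\<^esub>"
        using j.hom_one by (simp add: f_def)
      then have "g ` N #>\<^bsub>S\<^esub> g a = \<one>\<^bsub>S Mod g ` N\<^esub>"
        using j ga monoid.one_closed[OF group.is_monoid[OF gN.factorgroup_is_group]]
        by (intro inj_onD[of j "carrier (S Mod g ` N)"])
          (auto simp: iso_def bij_betw_def carrier_FactGroup simp del: one_FactGroup)
      then show "g ` N #>\<^bsub>S\<^esub> g a = g ` N" by simp
    next
      assume "g ` N #>\<^bsub>S\<^esub> g a = g ` N"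
      then show "f a = \<one>\<^bsub>Y\<^esub>" using j.hom_one by (simp add: f_def)
    qed
    also have "\<dots> \<longleftrightarrow> g a \<in> g ` N"
      using S.coset_join1[OF _ ga gN.subgroup_axioms] S.coset_join2[OF ga gN.subgroup_axioms] gN.subset by blast
    finally show ?thesis .
  qed
  have "\<forall>n \<in> N. f n = \<one>\<^bsub>Y\<^esub>" using f_one N.mem_carrier by blast
  then show ?thesis using Y(1) f_epi f_one[OF x(1)] x(2) by blast
qed

lemma residually_Mod:
  assumes "group_class \<C>" and "group G" and N: "N \<lhd> G"
    and sep: "\<And>x. \<lbrakk>x \<in> carrier G; x \<notin> N\<rbrakk>
      \<Longrightarrow> \<exists>Y f. \<C> Y \<and> f \<in> epi G Y \<and> (\<forall>n \<in> N. f n = \<one>\<^bsub>Y\<^esub>) \<and> f x \<noteq> \<one>\<^bsub>Y\<^esub>"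
  shows "residually \<C> (G Mod N)"
  unfolding residually_def
proof (intro ballI impI)
  interpret N: normal N G by fact
  fix u assume u: "u \<in> carrier (G Mod N)" "u \<noteq> \<one>\<^bsub>G Mod N\<^esub>"
  then obtain x where x: "x \<in> carrier G" "u = N #>\<^bsub>G\<^esub> x" by (auto simp: carrier_FactGroup)
  then have "x \<notin> N" using u(2) N.rcos_const by auto
  then obtain Y f where Y: "\<C> Y" "f \<in> epi G Y" "\<forall>n \<in> N. f n = \<one>\<^bsub>Y\<^esub>" "f x \<noteq> \<one>\<^bsub>Y\<^esub>"
    using sep x(1) by blast
  interpret group_hom G Y f using epi_group_hom assms(1,2) Y(1,2) by blast
  have "N \<subseteq> kernel G Y f" using Y(3) N.mem_carrier by (auto simp: kernel_def)
  then obtain g where g: "g \<in> hom (G Mod N) Y" "\<And>x. x \<in> carrier G \<Longrightarrow> g (N #>\<^bsub>G\<^esub> x) = f x"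
    using FactGroup_universal_kernel[OF N] by blast
  have "g \<in> epi (G Mod N) Y"
    using g Y(2) by (auto simp: epi_iff_subset carrier_FactGroup image_iff subset_iff)
  then show "\<exists>X f. \<C> X \<and> f \<in> epi (G Mod N) X \<and> f u \<noteq> \<one>\<^bsub>X\<^esub>"
    using g(2)[OF x(1)] x(2) Y(1,4) by metis
qed

text \<open>Here \<open>G = A K\<close>, and \<open>f'\<close> corresponds to \<open>f\<close> under the isomorphism of \<open>G / A\<close> with
  \<open>K / (A \<inter> K)\<close>.\<close>

lemma (in group) extend_epi_along_complement:
  assumes A: "A \<lhd> G" and K: "subgroup K G"
    and prod: "\<And>x. x \<in> carrier G \<Longrightarrow> \<exists>k \<in> K. x \<otimes> inv k \<in> A"
    and f: "f \<in> epi (G\<lparr>carrier := K\<rparr>) Y" and Y: "group Y"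
    and one: "\<And>x. x \<in> A \<inter> K \<Longrightarrow> f x = \<one>\<^bsub>Y\<^esub>"
  obtains f' where "f' \<in> epi G Y" and "\<And>x. x \<in> A \<Longrightarrow> f' x = \<one>\<^bsub>Y\<^esub>"
    and "\<And>k. k \<in> K \<Longrightarrow> f' k = f k"
proof -
  interpret A: normal A G by fact
  interpret f: group_hom "G\<lparr>carrier := K\<rparr>" Y f
    using f Y subgroup_imp_group[OF K] by (simp add: group_hom_def group_hom_axioms_def epi_iff_subset)
  note KG = subgroup.mem_carrier[OF K]
  define \<kappa> where "\<kappa> x = (SOME k. k \<in> K \<and> x \<otimes> inv k \<in> A)" for x
  have \<kappa>: "\<kappa> x \<in> K" "x \<otimes> inv (\<kappa> x) \<in> A" if "x \<in> carrier G" for x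
    using someI_ex[of "\<lambda>k. k \<in> K \<and> x \<otimes> inv k \<in> A"] prod[OF that] unfolding \<kappa>_def by auto
  have uniq: "f (\<kappa> x) = f k" if x: "x \<in> carrier G" and k: "k \<in> K" "x \<otimes> inv k \<in> A" for x k
  proof -
    have "inv (x \<otimes> inv k) \<otimes> (x \<otimes> inv (\<kappa> x)) \<in> A"
      using \<kappa>(2)[OF x] k(2) by blast
    moreover have "inv (x \<otimes> inv k) \<otimes> (x \<otimes> inv (\<kappa> x)) = k \<otimes> inv (\<kappa> x)"
    proof -
      have "inv (x \<otimes> inv k) \<otimes> (x \<otimes> inv (\<kappa> x)) = k \<otimes> (inv x \<otimes> x) \<otimes> inv (\<kappa> x)"
        using x KG[OF k(1)] KG[OF \<kappa>(1)[OF x]] by (simp only: inv_mult_group inv_inv m_assoc inv_closed m_closed)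
      then show ?thesis using x KG[OF k(1)] by simp
    qed
    ultimately have a: "k \<otimes> inv (\<kappa> x) \<in> A \<inter> K"
      using k \<kappa>(1)[OF x] subgroup.m_closed[OF K] subgroup.m_inv_closed[OF K] by simp
    have "f ((k \<otimes> inv (\<kappa> x)) \<otimes> \<kappa> x) = f (k \<otimes> inv (\<kappa> x)) \<otimes>\<^bsub>Y\<^esub> f (\<kappa> x)"
      using f.hom_mult[of "k \<otimes> inv (\<kappa> x)" "\<kappa> x"] a \<kappa>(1)[OF x] by simp
    then show ?thesis
      using one[OF a] f.hom_closed[of "\<kappa> x"] \<kappa>(1)[OF x] KG[OF k(1)] KG[OF \<kappa>(1)[OF x]] by (simp add: m_assoc)
  qed
  have fK: "f (\<kappa> k) = f k" if "k \<in> K" for k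
    using that KG[OF that] by (intro uniq) simp_all
  show thesis
  proof (rule that[of "\<lambda>x. f (\<kappa> x)"])
    have "f (\<kappa> (x \<otimes> y)) = f (\<kappa> x) \<otimes>\<^bsub>Y\<^esub> f (\<kappa> y)" if xy: "x \<in> carrier G" "y \<in> carrier G" for x y
    proof -
      have c: "\<kappa> x \<in> carrier G" "\<kappa> y \<in> carrier G" using xy \<kappa> KG by blast+
      have "(x \<otimes> (y \<otimes> inv (\<kappa> y)) \<otimes> inv x) \<otimes> (x \<otimes> inv (\<kappa> x)) \<in> A"
        using \<kappa>(2) xy A.inv_op_closed2 A.m_closed by blast
      moreover have "(x \<otimes> (y \<otimes> inv (\<kappa> y)) \<otimes> inv x) \<otimes> (x \<otimes> inv (\<kappa> x)) = (x \<otimes> y) \<otimes> inv (\<kappa> x \<otimes> \<kappa> y)"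
      proof -
        have "(x \<otimes> (y \<otimes> inv (\<kappa> y)) \<otimes> inv x) \<otimes> (x \<otimes> inv (\<kappa> x))
            = x \<otimes> (y \<otimes> (inv (\<kappa> y) \<otimes> ((inv x \<otimes> x) \<otimes> inv (\<kappa> x))))"
          using xy c by (simp only: m_assoc m_closed inv_closed)
        then show ?thesis using xy c by (simp add: inv_mult_group m_assoc)
      qed
      ultimately have "f (\<kappa> (x \<otimes> y)) = f (\<kappa> x \<otimes> \<kappa> y)"
        using xy \<kappa>(1) subgroup.m_closed[OF K] by (intro uniq) simp_all
      then show ?thesis using f.hom_mult[of "\<kappa> x" "\<kappa> y"] \<kappa>(1) xy by simp
    qed
    moreover have "carrier Y \<subseteq> (\<lambda>x. f (\<kappa> x)) ` carrier G"
    proof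
      fix y assume "y \<in> carrier Y"
      then obtain k where "k \<in> K" "y = f k" using f by (auto simp: epi_iff_subset)
      then show "y \<in> (\<lambda>x. f (\<kappa> x)) ` carrier G" using fK KG by (metis imageI)
    qed
    ultimately show "(\<lambda>x. f (\<kappa> x)) \<in> epi G Y"
      using \<kappa>(1) f.hom_closed by (auto simp: epi_iff_subset hom_def)
    fix x assume "x \<in> A"
    then have "f (\<kappa> x) = f \<one>"
      using subgroup.one_closed[OF K] A.mem_carrier by (intro uniq) simp_all
    then show "f (\<kappa> x) = \<one>\<^bsub>Y\<^esub>" using f.hom_one by simp
  qed (rule fK)
qed

section \<open>Failure of identities\<close>

context hnn_data
begin

interpretation E: group E by (rule group_E)

interpretation base: group_hom B E base
  using base_hom by unfold_locales

lemma base_closed: "x \<in> carrier B \<Longrightarrow> base x \<in> carrier E"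
  by (rule base.hom_closed)

lemma base_mult:
  "\<lbrakk>x \<in> carrier B; y \<in> carrier B\<rbrakk> \<Longrightarrow> base x \<otimes>\<^bsub>E\<^esub> base y = base (x \<otimes> y)"
  by simp

lemma inv_letter: "inv\<^bsub>E\<^esub> (letter e) = letter (\<not> e)"
  using letter_letter[of "\<not> e"] by (intro E.inv_equality) (simp_all add: letter_closed)

lemma letter_letter': "letter (\<not> e) \<otimes>\<^bsub>E\<^esub> letter e = \<one>\<^bsub>E\<^esub>"
  using letter_letter[of "\<not> e"] by simp

lemma letter_letter_left:
  "z \<in> carrier E \<Longrightarrow> letter e \<otimes>\<^bsub>E\<^esub> (letter (\<not> e) \<otimes>\<^bsub>E\<^esub> z) = z"
  "z \<in> carrier E \<Longrightarrow> letter (\<not> e) \<otimes>\<^bsub>E\<^esub> (letter e \<otimes>\<^bsub>E\<^esub> z) = z"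
  by (simp_all add: E.m_assoc[symmetric] letter_closed letter_letter letter_letter')

lemma letter_conj:
  assumes "x \<in> assoc e"
  shows "letter e \<otimes>\<^bsub>E\<^esub> base x \<otimes>\<^bsub>E\<^esub> letter (\<not> e) = base (twist e x)"
proof (cases e)
  case False
  then show ?thesis using letter_conj_False assms by simp
next
  case True
  define h where "h = twist True x"
  have h: "h \<in> assoc False" "x = twist False h"
    using assms twist_closed[of x True] twist_twist[of x True] True by (simp_all add: h_def)
  have "base x = letter False \<otimes>\<^bsub>E\<^esub> base h \<otimes>\<^bsub>E\<^esub> letter True"
    unfolding h(2) by (rule letter_conj_False[OF h(1), symmetric])
  then show ?thesis
    using True assoc_closed[OF h(1)] letter_letter_left[of _ True] letter_letter[of True]
    by (simp add: E.m_assoc letter_closed base_closed h_def)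
qed

lemma path_closed: "snd ` set l \<subseteq> carrier B \<Longrightarrow> path l \<in> carrier E"
  by (induction l rule: path.induct) (auto simp: letter_closed base_closed)

lemma path_append:
  "\<lbrakk>snd ` set l \<subseteq> carrier B; snd ` set m \<subseteq> carrier B\<rbrakk> \<Longrightarrow> path (l @ m) = path l \<otimes>\<^bsub>E\<^esub> path m"
  by (induction l rule: path.induct) (auto simp: letter_closed base_closed path_closed E.m_assoc)

lemma reduced_closed: "reduced l \<Longrightarrow> snd ` set l \<subseteq> carrier B"
  by (simp add: reduced_def)

lemma reduced_Cons:
  "reduced ((e, x) # l) \<longleftrightarrow>
    x \<in> carrier B \<and> reduced l \<and> (l = [] \<or> fst (hd l) = e \<or> x \<notin> assoc e)"
  by (auto simp: reduced_def successively_Cons split: prod.splits)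

lemma reduced_append:
  "reduced (l @ (e, x) # m) \<longleftrightarrow> reduced (l @ [(e, \<one>)]) \<and> reduced ((e, x) # m)"
  by (auto simp: reduced_def successively_append_iff split: prod.splits)

text \<open>For \<open>s\<close> false, \<open>starts s\<close> and \<open>links s\<close> single out the elements with a reduced form beginning with
  \<open>t\<close>, and among them those whose form also ends with \<open>t\<inverse>\<close>.  A link can be followed by a base
  element outside \<open>assoc s\<close> and then by anything that starts with \<open>t\<close>, without creating a
  cancellation.\<close>

definition starts :: "bool \<Rightarrow> 'b hnn_letter list set \<Rightarrow> bool" where
  "starts s x \<longleftrightarrow> (\<exists>l. reduced l \<and> l \<noteq> [] \<and> fst (hd l) = (\<not> s) \<and> x = path l)"

definition links :: "bool \<Rightarrow> 'b hnn_letter list set \<Rightarrow> bool" where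
  "links s x \<longleftrightarrow> (\<exists>l. reduced (l @ [(s, \<one>)]) \<and> l \<noteq> [] \<and> fst (hd l) = (\<not> s)
     \<and> x = path l \<otimes>\<^bsub>E\<^esub> letter s)"

lemma starts_not_one: "\<not> starts s \<one>\<^bsub>E\<^esub>"
  using britton by (metis starts_def)

lemma linksI:
  assumes "reduced (l @ [(s, \<one>)])" "l \<noteq> []" "fst (hd l) = (\<not> s)" "x = path l \<otimes>\<^bsub>E\<^esub> letter s"
  shows "links s x"
  using assms by (auto simp: links_def)

lemma links_imp_starts:
  assumes "links s x"
  shows "starts s x"
proof -
  obtain l where l: "reduced (l @ [(s, \<one>)])" "l \<noteq> []" "fst (hd l) = (\<not> s)" "x = path l \<otimes>\<^bsub>E\<^esub> letter s"
    using assms by (auto simp: links_def)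
  have "x = path (l @ [(s, \<one>)])"
    using reduced_closed[OF l(1)] l(4) by (simp add: path_append letter_closed)
  then show ?thesis using l by (auto simp: starts_def)
qed

lemma links_mult:
  assumes "links s x" and "starts s y" and b: "b \<in> carrier B" "b \<notin> assoc s"
  shows "starts s (x \<otimes>\<^bsub>E\<^esub> (base b \<otimes>\<^bsub>E\<^esub> y))"
proof -
  obtain l where l: "reduced (l @ [(s, \<one>)])" "l \<noteq> []" "fst (hd l) = (\<not> s)" "x = path l \<otimes>\<^bsub>E\<^esub> letter s"
    using assms(1) by (auto simp: links_def)
  obtain m where m: "reduced m" "m \<noteq> []" "fst (hd m) = (\<not> s)" "y = path m"
    using assms(2) by (auto simp: starts_def)
  have "reduced (l @ (s, b) # m)"
    using l m b reduced_append[of l s b m] by (simp add: reduced_Cons)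
  moreover have "x \<otimes>\<^bsub>E\<^esub> (base b \<otimes>\<^bsub>E\<^esub> y) = path (l @ (s, b) # m)"
    using reduced_closed[OF l(1)] reduced_closed[OF m(1)] b(1)
    by (simp add: l(4) m(4) path_append path_closed letter_closed base_closed E.m_assoc)
  ultimately show ?thesis using l by (auto simp: starts_def)
qed

lemma pow_left_cancel:
  assumes g: "g \<in> carrier E" and "i < j"
  shows "inv\<^bsub>E\<^esub> (g [^]\<^bsub>E\<^esub> (i::nat)) \<otimes>\<^bsub>E\<^esub> g [^]\<^bsub>E\<^esub> j = g [^]\<^bsub>E\<^esub> Suc (j - i - 1)"
    and "inv\<^bsub>E\<^esub> (g [^]\<^bsub>E\<^esub> j) \<otimes>\<^bsub>E\<^esub> g [^]\<^bsub>E\<^esub> i = (inv\<^bsub>E\<^esub> g) [^]\<^bsub>E\<^esub> Suc (j - i - 1)"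
proof -
  define m where "m = Suc (j - i - 1)"
  have j: "g [^]\<^bsub>E\<^esub> j = g [^]\<^bsub>E\<^esub> i \<otimes>\<^bsub>E\<^esub> g [^]\<^bsub>E\<^esub> m"
    using assms(2) E.nat_pow_mult[OF g, of i m] by (simp add: m_def)
  show "inv\<^bsub>E\<^esub> (g [^]\<^bsub>E\<^esub> i) \<otimes>\<^bsub>E\<^esub> g [^]\<^bsub>E\<^esub> j = g [^]\<^bsub>E\<^esub> Suc (j - i - 1)"
    unfolding j m_def[symmetric] using g by (simp add: E.m_assoc[symmetric] E.nat_pow_closed)
  have "inv\<^bsub>E\<^esub> (g [^]\<^bsub>E\<^esub> j) \<otimes>\<^bsub>E\<^esub> g [^]\<^bsub>E\<^esub> i = inv\<^bsub>E\<^esub> (g [^]\<^bsub>E\<^esub> m)"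
    unfolding j using g by (simp add: E.inv_mult_group E.m_assoc E.nat_pow_closed)
  then show "inv\<^bsub>E\<^esub> (g [^]\<^bsub>E\<^esub> j) \<otimes>\<^bsub>E\<^esub> g [^]\<^bsub>E\<^esub> i = (inv\<^bsub>E\<^esub> g) [^]\<^bsub>E\<^esub> Suc (j - i - 1)"
    using g by (simp only: m_def E.nat_pow_inv)
qed

text \<open>The conjugating elements \<open>y\<^sub>i = g\<^sup>i q\<close> are chosen so that \<open>y\<^sub>i\<inverse> y\<^sub>j = q\<inverse> g\<^bsup>j - i\<^esup> q\<close> depends only on
  \<open>j - i\<close>.\<close>

definition spread_conj ::
  "'b hnn_letter list set \<Rightarrow> 'b hnn_letter list set \<Rightarrow> 'b \<Rightarrow> nat \<Rightarrow> 'b hnn_letter list set" where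
  "spread_conj g q b i =
    (g [^]\<^bsub>E\<^esub> i \<otimes>\<^bsub>E\<^esub> q) \<otimes>\<^bsub>E\<^esub> base b \<otimes>\<^bsub>E\<^esub> inv\<^bsub>E\<^esub> (g [^]\<^bsub>E\<^esub> i \<otimes>\<^bsub>E\<^esub> q)"

text \<open>Let \<open>b\<^sub>i = y\<^sub>i b y\<^sub>i\<inverse>\<close>.  In a product of factors \<open>b\<^sub>i\<^bsup>\<plusminus>1\<^esup>\<close> with different neighbouring indices, neighbours
  meet in a link \<open>y\<^sub>i\<inverse> y\<^sub>j\<close>, so the product is in reduced form up to its ends.  Substituting
  \<open>b\<^sub>2\<^sub>i b\<^sub>2\<^sub>i\<^sub>+\<^sub>1\<close> for \<open>x\<^sub>i\<close> turns every freely reduced word into such a product, even where a letter is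
  repeated.  The ends are taken care of by conjugation with \<open>y\<^sub>n\<close> for an index \<open>n\<close> that does not occur:
  the result starts with a link and so is not trivial.\<close>

lemma spread_conj_no_identity:
  assumes g: "g \<in> carrier E" and q: "q \<in> carrier E"
    and b: "b \<in> carrier B" "b \<notin> assoc s"
    and links_pos: "\<And>m. links s (inv\<^bsub>E\<^esub> q \<otimes>\<^bsub>E\<^esub> g [^]\<^bsub>E\<^esub> Suc m \<otimes>\<^bsub>E\<^esub> q)"
    and links_neg: "\<And>m. links s (inv\<^bsub>E\<^esub> q \<otimes>\<^bsub>E\<^esub> (inv\<^bsub>E\<^esub> g) [^]\<^bsub>E\<^esub> Suc m \<otimes>\<^bsub>E\<^esub> q)"
    and w: "freely_reduced w" "w \<noteq> []"
  shows "word_value E (\<lambda>i. spread_conj g q b (2 * i) \<otimes>\<^bsub>E\<^esub> spread_conj g q b (2 * i + 1)) w \<noteq> \<one>\<^bsub>E\<^esub>"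
    (is "word_value E ?v w \<noteq> _")
proof -
  define y where "y i = g [^]\<^bsub>E\<^esub> (i::nat) \<otimes>\<^bsub>E\<^esub> q" for i
  have y: "y i \<in> carrier E" for i using g q by (simp add: y_def E.nat_pow_closed)
  have y_links: "links s (inv\<^bsub>E\<^esub> (y i) \<otimes>\<^bsub>E\<^esub> y j)" if ij: "i \<noteq> j" for i j
  proof -
    have eq: "inv\<^bsub>E\<^esub> (y i) \<otimes>\<^bsub>E\<^esub> y j = inv\<^bsub>E\<^esub> q \<otimes>\<^bsub>E\<^esub> (inv\<^bsub>E\<^esub> (g [^]\<^bsub>E\<^esub> i) \<otimes>\<^bsub>E\<^esub> g [^]\<^bsub>E\<^esub> j) \<otimes>\<^bsub>E\<^esub> q"
      using g q by (simp add: y_def E.inv_mult_group E.m_assoc E.nat_pow_closed)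
    consider "i < j" | "j < i" using ij by linarith
    then show ?thesis
    proof cases
      case 1
      show ?thesis unfolding eq pow_left_cancel(1)[OF g 1] by (rule links_pos)
    next
      case 2
      show ?thesis unfolding eq pow_left_cancel(2)[OF g 2] by (rule links_neg)
    qed
  qed
  define c where "c e i = y i \<otimes>\<^bsub>E\<^esub> base (if e then b else inv b) \<otimes>\<^bsub>E\<^esub> inv\<^bsub>E\<^esub> (y i)" for e i
  have c: "c e i \<in> carrier E" for e i using y b by (simp add: c_def base_closed)
  have c_inv: "inv\<^bsub>E\<^esub> (c True i) = c False i" for i
    using y b by (simp add: c_def base_closed E.inv_mult_group E.m_assoc)
  have v: "spread_conj g q b i = c True i" for i
    by (simp add: spread_conj_def c_def y_def)
  have vc: "?v \<in> UNIV \<rightarrow> carrier E" unfolding v using c by auto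
  obtain n where n: "n \<notin> (\<lambda>(i, e). 2 * i) ` set w \<union> (\<lambda>(i, e). 2 * i + 1) ` set w"
    using ex_new_if_finite[OF infinite_UNIV_nat,
        of "(\<lambda>(i, e). 2 * i) ` set w \<union> (\<lambda>(i, e). 2 * i + 1) ` set w"] by auto
  \<comment> \<open>\<open>P k x\<close>: a factor with index \<open>k\<close> meets no cancellation in front of \<open>x y\<^sub>n\<close>\<close>
  define P where "P k x \<longleftrightarrow> starts s (inv\<^bsub>E\<^esub> (y k) \<otimes>\<^bsub>E\<^esub> (x \<otimes>\<^bsub>E\<^esub> y n))" for k x
  have step: "P k (c e i \<otimes>\<^bsub>E\<^esub> x)" if "P i x" "k \<noteq> i" "x \<in> carrier E" for k i x e
  proof -
    have "(if e then b else inv b) \<notin> assoc s" using b assoc_inv[of "inv b" s] by auto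
    moreover have "(if e then b else inv b) \<in> carrier B" using b by simp
    ultimately have "starts s ((inv\<^bsub>E\<^esub> (y k) \<otimes>\<^bsub>E\<^esub> y i) \<otimes>\<^bsub>E\<^esub>
        (base (if e then b else inv b) \<otimes>\<^bsub>E\<^esub> (inv\<^bsub>E\<^esub> (y i) \<otimes>\<^bsub>E\<^esub> (x \<otimes>\<^bsub>E\<^esub> y n))))"
      using that(1) y_links[OF that(2)] unfolding P_def by (intro links_mult)
    then show ?thesis
      using y that(3) b by (simp add: P_def c_def base_closed E.m_assoc)
  qed
  \<comment> \<open>the index of the first of the two factors that replace a letter\<close>
  define first where "first a = (case a of (i, e) \<Rightarrow> if e then 2 * i else 2 * i + 1)" for a :: "nat \<times> bool"
  have "P k (word_value E ?v u)"
    if "freely_reduced u" "n \<notin> (\<lambda>(i, e). 2 * i) ` set u \<union> (\<lambda>(i, e). 2 * i + 1) ` set u"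
      "k \<noteq> (if u = [] then n else first (hd u))" for u k
    using that
  proof (induction u arbitrary: k)
    case Nil
    then show ?case using links_imp_starts[OF y_links[of k n]] y by (simp add: P_def)
  next
    case (Cons a u)
    obtain i e where a: "a = (i, e)" by fastforce
    define last where "last = (if e then 2 * i + 1 else 2 * i)"
    have ne: "first a \<noteq> last" by (simp add: first_def a last_def)
    have "last \<noteq> (if u = [] then n else first (hd u))"
    proof (cases "u = []")
      case True
      then show ?thesis using Cons.prems(2) by (auto simp: a last_def)
    next
      case False
      obtain j f where hd: "hd u = (j, f)" by fastforce
      have "\<not> (j = i \<and> f \<noteq> e)"
        using Cons.prems(1) False hd by (auto simp: freely_reduced_def successively_Cons a)
      then show ?thesis
        using False unfolding hd first_def last_def by (cases e; cases f; simp; presburger)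
    qed
    then have "P last (word_value E ?v u)"
      using Cons.prems(1,2) by (intro Cons.IH) (auto simp: freely_reduced_def successively_Cons)
    then have P2: "P k (c e (first a) \<otimes>\<^bsub>E\<^esub> (c e last \<otimes>\<^bsub>E\<^esub> word_value E ?v u))"
      using ne Cons.prems(3) c E.word_value_closed[OF vc] by (intro step) auto
    have "(if e then ?v i else inv\<^bsub>E\<^esub> (?v i)) = c e (first a) \<otimes>\<^bsub>E\<^esub> c e last"
      unfolding v using c c_inv by (simp add: first_def last_def a E.inv_mult_group)
    then have "word_value E ?v (a # u) = (c e (first a) \<otimes>\<^bsub>E\<^esub> c e last) \<otimes>\<^bsub>E\<^esub> word_value E ?v u"
      by (simp only: a word_value.simps)
    also have "\<dots> = c e (first a) \<otimes>\<^bsub>E\<^esub> (c e last \<otimes>\<^bsub>E\<^esub> word_value E ?v u)"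
      by (rule E.m_assoc[OF c c E.word_value_closed[OF vc]])
    finally show ?case using P2 by (simp only:)
  qed
  moreover have "n \<noteq> first (hd w)"
    using n w(2) by (cases w) (auto simp: first_def split: if_splits)
  ultimately have "P n (word_value E ?v w)" using w n by simp
  then show ?thesis using starts_not_one y by (auto simp: P_def)
qed

end

section \<open>The closures of the associated subgroups\<close>

locale separated_hnn = hnn_data B H K \<phi>
  for B :: "('b, 'm) monoid_scheme" (structure) and H K :: "'b set" and \<phi> :: "'b \<Rightarrow> 'b" +
  fixes \<C> :: "'u monoid \<Rightarrow> bool"
  assumes normal_H: "H \<lhd> B" and normal_K: "K \<lhd> B"
    and \<phi>_core: "\<phi> ` (H \<inter> K) = H \<inter> K"
    and \<C>_group: "group_class \<C>" and \<C>_sub: "subgroup_closed \<C>" and \<C>_quot: "quotient_closed \<C>"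
    and residually_E: "residually \<C> E"
begin

interpretation E: group E by (rule group_E)

interpretation base: group_hom B E base
  using base_hom by unfold_locales

lemma normal_assoc: "assoc e \<lhd> B"
  by (simp add: assoc_def normal_H normal_K)

lemma assoc_conj:
  assumes "x \<in> assoc e" and "b \<in> carrier B"
  shows "b \<otimes> x \<otimes> inv b \<in> assoc e" and "inv b \<otimes> x \<otimes> b \<in> assoc e"
  using normal.inv_op_closed2[OF normal_assoc] normal.inv_op_closed1[OF normal_assoc] assms by blast+

lemma assoc_conj_iff:
  assumes "x \<in> carrier B" and "b \<in> carrier B"
  shows "inv b \<otimes> x \<otimes> b \<in> assoc e \<longleftrightarrow> x \<in> assoc e"
proof
  assume "inv b \<otimes> x \<otimes> b \<in> assoc e"
  then have "b \<otimes> (inv b \<otimes> x \<otimes> b) \<otimes> inv b \<in> assoc e" by (rule assoc_conj(1)[OF _ assms(2)])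
  moreover have "b \<otimes> (inv b \<otimes> x \<otimes> b) \<otimes> inv b = x"
  proof -
    have "b \<otimes> (inv b \<otimes> x \<otimes> b) \<otimes> inv b = (b \<otimes> inv b) \<otimes> x \<otimes> (b \<otimes> inv b)"
      using assms by (simp only: m_assoc m_closed inv_closed)
    then show ?thesis using assms by simp
  qed
  ultimately show "x \<in> assoc e" by metis
qed (use assoc_conj assms in blast)

lemma assoc_inv_iff: "x \<in> carrier B \<Longrightarrow> inv x \<in> assoc e \<longleftrightarrow> x \<in> assoc e"
  using assoc_inv[of x e] assoc_inv[of "inv x" e] by auto

lemma core_eq: "assoc e \<inter> assoc (\<not> e) = H \<inter> K"
  by (auto simp: assoc_def)

lemma twist_core: "x \<in> H \<inter> K \<Longrightarrow> twist e x \<in> H \<inter> K"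
proof (cases e)
  case True
  assume "x \<in> H \<inter> K"
  then obtain y where "y \<in> H \<inter> K" "x = \<phi> y" using \<phi>_core by blast
  then show ?thesis using bij_\<phi> True by (simp add: twist_def bij_betw_inv_into_left)
qed (use \<phi>_core in \<open>auto simp: twist_def\<close>)

text \<open>The inclusion makes \<open>assoc s\<close> equal to \<open>H \<inter> K\<close>, which \<open>twist s\<close> maps into itself, whereas it maps
  \<open>assoc s\<close> onto \<open>assoc (\<not> s)\<close>.\<close>

lemma assoc_eq_if_subset:
  assumes "assoc s \<subseteq> assoc (\<not> s)"
  shows "assoc (\<not> s) = assoc s"
proof -
  have "assoc (\<not> s) \<subseteq> twist s ` assoc s"
    using bij_twist[of s] by (simp add: bij_betw_def)
  also have "\<dots> \<subseteq> H \<inter> K"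
    using twist_core core_eq[of s] assms by blast
  finally show ?thesis using assms core_eq[of s] by blast
qed

definition closure :: "'b set \<Rightarrow> 'b hnn_letter list set set" where
  "closure S = pro_closure \<C> E (base ` S)"

definition normalizes :: "'b set \<Rightarrow> 'b hnn_letter list set \<Rightarrow> bool" where
  "normalizes S y \<longleftrightarrow> y \<in> carrier E \<and> (\<forall>x \<in> base ` S. y \<otimes>\<^bsub>E\<^esub> x \<otimes>\<^bsub>E\<^esub> inv\<^bsub>E\<^esub> y \<in> base ` S)"

lemma normalizes_mult:
  assumes "S \<subseteq> carrier B" and y: "normalizes S y" and z: "normalizes S z"
  shows "normalizes S (y \<otimes>\<^bsub>E\<^esub> z)"
proof -
  have c: "y \<in> carrier E" "z \<in> carrier E" using y z by (auto simp: normalizes_def)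
  have "(y \<otimes>\<^bsub>E\<^esub> z) \<otimes>\<^bsub>E\<^esub> x \<otimes>\<^bsub>E\<^esub> inv\<^bsub>E\<^esub> (y \<otimes>\<^bsub>E\<^esub> z) \<in> base ` S" if x: "x \<in> base ` S" for x
  proof -
    have "x \<in> carrier E" using x assms(1) base_closed by blast
    then have eq: "(y \<otimes>\<^bsub>E\<^esub> z) \<otimes>\<^bsub>E\<^esub> x \<otimes>\<^bsub>E\<^esub> inv\<^bsub>E\<^esub> (y \<otimes>\<^bsub>E\<^esub> z)
        = y \<otimes>\<^bsub>E\<^esub> (z \<otimes>\<^bsub>E\<^esub> x \<otimes>\<^bsub>E\<^esub> inv\<^bsub>E\<^esub> z) \<otimes>\<^bsub>E\<^esub> inv\<^bsub>E\<^esub> y"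
      using c by (simp add: E.m_assoc E.inv_mult_group)
    have "z \<otimes>\<^bsub>E\<^esub> x \<otimes>\<^bsub>E\<^esub> inv\<^bsub>E\<^esub> z \<in> base ` S"
      using x z unfolding normalizes_def by blast
    then show ?thesis unfolding eq using y unfolding normalizes_def by blast
  qed
  then show ?thesis using c by (simp add: normalizes_def)
qed

lemma normalizes_pow:
  assumes "S \<subseteq> carrier B" and g: "normalizes S g"
  shows "normalizes S (g [^]\<^bsub>E\<^esub> (n::nat))"
proof (induction n)
  case 0
  have "base x \<in> carrier E" if "x \<in> S" for x using that assms(1) base_closed by blast
  then show ?case by (simp add: normalizes_def)
next
  case (Suc n)
  then show ?case using normalizes_mult[OF assms(1) Suc g] by simp
qed

lemma closure_conj:
  assumes "S \<subseteq> carrier B" and "x \<in> closure S" and "normalizes S y"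
  shows "y \<otimes>\<^bsub>E\<^esub> x \<otimes>\<^bsub>E\<^esub> inv\<^bsub>E\<^esub> y \<in> closure S"
proof -
  have "base ` S \<subseteq> carrier E" using assms(1) base_closed by blast
  then show ?thesis
    using assms(3) unfolding closure_def normalizes_def
    by (intro pro_closure_conj[OF \<C>_group group_E _ assms(2)[unfolded closure_def]]) blast+
qed

lemma closure_commute:
  assumes "S \<subseteq> carrier B" and "x \<in> closure S" and "y \<in> carrier E"
    and "\<And>a. a \<in> S \<Longrightarrow> y \<otimes>\<^bsub>E\<^esub> base a = base a \<otimes>\<^bsub>E\<^esub> y"
  shows "y \<otimes>\<^bsub>E\<^esub> x = x \<otimes>\<^bsub>E\<^esub> y"
proof -
  have "base ` S \<subseteq> carrier E" using assms(1) base_closed by blast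
  then show ?thesis
    using assms(4)
    by (intro pro_closure_commute[OF \<C>_group residually_E group_E _ assms(2)[unfolded closure_def] assms(3)]) blast+
qed

lemma normalizes_base:
  assumes "S \<lhd> B" and "b \<in> carrier B"
  shows "normalizes S (base b)"
proof -
  have "base b \<otimes>\<^bsub>E\<^esub> base a \<otimes>\<^bsub>E\<^esub> inv\<^bsub>E\<^esub> (base b) \<in> base ` S" if a: "a \<in> S" for a
  proof -
    have "a \<in> carrier B" using a assms(1) normal_imp_subgroup subgroup.mem_carrier by metis
    then have "base b \<otimes>\<^bsub>E\<^esub> base a \<otimes>\<^bsub>E\<^esub> inv\<^bsub>E\<^esub> (base b) = base (b \<otimes> a \<otimes> inv b)"
      using assms(2) by simp
    then show ?thesis using normal.inv_op_closed2[OF assms(1,2) a] by simp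
  qed
  then show ?thesis using assms(2) by (auto simp: normalizes_def base_closed)
qed

lemma normalizes_letter_core: "normalizes (H \<inter> K) (letter e)"
proof -
  have "letter e \<otimes>\<^bsub>E\<^esub> base x \<otimes>\<^bsub>E\<^esub> letter (\<not> e) \<in> base ` (H \<inter> K)" if "x \<in> H \<inter> K" for x
    using letter_conj[of x e] twist_core[OF that, of e] that core_eq[of e] by blast
  then show ?thesis by (auto simp: normalizes_def letter_closed inv_letter)
qed

text \<open>For \<open>s\<close> false this is \<open>t c t\<inverse>\<close>, which normalizes \<open>H = t K t\<inverse>\<close>.\<close>

definition bent :: "bool \<Rightarrow> 'b \<Rightarrow> 'b hnn_letter list set" where
  "bent s c = letter (\<not> s) \<otimes>\<^bsub>E\<^esub> (base c \<otimes>\<^bsub>E\<^esub> letter s)"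

lemma bent_closed: "c \<in> carrier B \<Longrightarrow> bent s c \<in> carrier E"
  by (simp add: bent_def letter_closed base_closed)

lemma inv_bent: "c \<in> carrier B \<Longrightarrow> inv\<^bsub>E\<^esub> (bent s c) = bent s (inv c)"
  by (simp add: bent_def letter_closed base_closed E.inv_mult_group E.m_assoc inv_letter)

lemma bent_conj:
  assumes "h \<in> assoc s" and "c \<in> carrier B"
  shows "bent s c \<otimes>\<^bsub>E\<^esub> base h \<otimes>\<^bsub>E\<^esub> inv\<^bsub>E\<^esub> (bent s c) = base (twist (\<not> s) (c \<otimes> twist s h \<otimes> inv c))"
proof -
  have h: "h \<in> carrier B" "twist s h \<in> carrier B" "twist s h \<in> assoc (\<not> s)"
    using assms(1) assoc_closed twist_closed by blast+
  have "bent s c \<otimes>\<^bsub>E\<^esub> base h \<otimes>\<^bsub>E\<^esub> inv\<^bsub>E\<^esub> (bent s c)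
      = letter (\<not> s) \<otimes>\<^bsub>E\<^esub> (base c \<otimes>\<^bsub>E\<^esub> (letter s \<otimes>\<^bsub>E\<^esub> base h \<otimes>\<^bsub>E\<^esub> letter (\<not> s)) \<otimes>\<^bsub>E\<^esub> base (inv c)) \<otimes>\<^bsub>E\<^esub> letter s"
    using h assms by (simp add: inv_bent) (simp add: bent_def letter_closed base_closed E.m_assoc)
  also have "\<dots> = letter (\<not> s) \<otimes>\<^bsub>E\<^esub> base (c \<otimes> twist s h \<otimes> inv c) \<otimes>\<^bsub>E\<^esub> letter (\<not> \<not> s)"
    using h assms by (simp add: letter_conj)
  also have "\<dots> = base (twist (\<not> s) (c \<otimes> twist s h \<otimes> inv c))"
    by (rule letter_conj) (rule assoc_conj(1)[OF h(3) assms(2)])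
  finally show ?thesis .
qed

lemma normalizes_bent:
  assumes "c \<in> carrier B"
  shows "normalizes (assoc s) (bent s c)"
proof -
  have "twist (\<not> s) (c \<otimes> twist s h \<otimes> inv c) \<in> assoc s" if "h \<in> assoc s" for h
    using twist_closed[OF assoc_conj(1)[OF twist_closed[OF that] assms]] by simp
  then show ?thesis
    using bent_conj assms by (auto simp: normalizes_def bent_closed)
qed

text \<open>For \<open>s\<close> false: under \<open>\<phi>\<close>, conjugation by \<open>d\<close> on \<open>H\<close> corresponds to conjugation by \<open>c\<close> on \<open>K\<close>.\<close>

definition induced :: "bool \<Rightarrow> 'b \<Rightarrow> 'b \<Rightarrow> bool" where
  "induced s c d \<longleftrightarrow> (\<forall>h \<in> assoc s. twist s (inv d \<otimes> h \<otimes> d) = inv c \<otimes> twist s h \<otimes> c)"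

lemma induced_swap:
  assumes "induced s c d" and "c \<in> carrier B" and "d \<in> carrier B"
  shows "induced (\<not> s) d c"
  unfolding induced_def
proof
  fix k assume k: "k \<in> assoc (\<not> s)"
  define h where "h = twist (\<not> s) k"
  have h: "h \<in> assoc s" "twist s h = k"
    using twist_closed[OF k] k by (simp_all add: h_def)
  have "twist (\<not> s) (twist s (inv d \<otimes> h \<otimes> d)) = twist (\<not> s) (inv c \<otimes> k \<otimes> c)"
    using assms(1) h by (simp add: induced_def)
  then show "twist (\<not> s) (inv c \<otimes> k \<otimes> c) = inv d \<otimes> twist (\<not> s) k \<otimes> d"
    using twist_twist[OF assoc_conj(2)[OF h(1) assms(3)]] by (simp add: h_def)
qed

lemma assoc_proper:
  assumes "b \<in> carrier B" and "b \<notin> assoc s"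
  obtains c where "c \<in> carrier B" and "c \<notin> assoc (\<not> s)"
proof -
  have "assoc (\<not> s) \<noteq> carrier B"
  proof
    assume "assoc (\<not> s) = carrier B"
    then have "assoc s = carrier B" using assoc_eq_if_subset[of s] assoc_closed by blast
    then show False using assms by simp
  qed
  then show thesis using that assoc_closed by blast
qed

text \<open>With \<open>s\<close> false, the commutator of \<open>t c t\<inverse> d\<inverse>\<close> and \<open>b\<close> is
  \<open>t c t\<inverse> (d\<inverse> b d) t c\<inverse> t\<inverse> b\<inverse>\<close>, which is reduced.\<close>

lemma bent_not_commute:
  assumes b: "b \<in> carrier B" "b \<notin> assoc s" and c: "c \<in> carrier B" "c \<notin> assoc (\<not> s)"
    and d: "d \<in> carrier B"
  shows "(bent s c \<otimes>\<^bsub>E\<^esub> base (inv d)) \<otimes>\<^bsub>E\<^esub> base b \<noteq> base b \<otimes>\<^bsub>E\<^esub> (bent s c \<otimes>\<^bsub>E\<^esub> base (inv d))"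
proof
  let ?y = "bent s c \<otimes>\<^bsub>E\<^esub> base (inv d)"
  assume eq: "?y \<otimes>\<^bsub>E\<^esub> base b = base b \<otimes>\<^bsub>E\<^esub> ?y"
  have y: "?y \<in> carrier E" using c d by (simp add: bent_closed base_closed)
  have "?y \<otimes>\<^bsub>E\<^esub> base b \<otimes>\<^bsub>E\<^esub> inv\<^bsub>E\<^esub> ?y \<otimes>\<^bsub>E\<^esub> base (inv b) = \<one>\<^bsub>E\<^esub>"
    unfolding eq using y b by (simp add: E.m_assoc base_closed)
  moreover have "path [(\<not> s, c), (s, inv d \<otimes> b \<otimes> d), (\<not> s, inv c), (s, inv b)]
      = ?y \<otimes>\<^bsub>E\<^esub> base b \<otimes>\<^bsub>E\<^esub> inv\<^bsub>E\<^esub> ?y \<otimes>\<^bsub>E\<^esub> base (inv b)"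
    using b c d by (simp add: E.inv_mult_group bent_closed base_closed inv_bent)
      (simp add: bent_def letter_closed base_closed E.m_assoc)
  moreover have "reduced [(\<not> s, c), (s, inv d \<otimes> b \<otimes> d), (\<not> s, inv c), (s, inv b)]"
    using b c d assoc_conj_iff assoc_inv_iff by (simp add: reduced_Cons reduced_def)
  ultimately show False using britton by (metis list.distinct(1))
qed

lemma commutator_one:
  assumes x: "x \<in> carrier E" and z: "z \<in> carrier E" and comm: "z \<otimes>\<^bsub>E\<^esub> x = x \<otimes>\<^bsub>E\<^esub> z"
  shows "x \<otimes>\<^bsub>E\<^esub> inv\<^bsub>E\<^esub> z \<otimes>\<^bsub>E\<^esub> inv\<^bsub>E\<^esub> x \<otimes>\<^bsub>E\<^esub> z = \<one>\<^bsub>E\<^esub>"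
proof -
  have "x \<otimes>\<^bsub>E\<^esub> inv\<^bsub>E\<^esub> z \<otimes>\<^bsub>E\<^esub> inv\<^bsub>E\<^esub> x \<otimes>\<^bsub>E\<^esub> z = x \<otimes>\<^bsub>E\<^esub> inv\<^bsub>E\<^esub> (x \<otimes>\<^bsub>E\<^esub> z) \<otimes>\<^bsub>E\<^esub> z"
    using x z by (simp add: E.inv_mult_group E.m_assoc)
  also have "\<dots> = x \<otimes>\<^bsub>E\<^esub> inv\<^bsub>E\<^esub> (z \<otimes>\<^bsub>E\<^esub> x) \<otimes>\<^bsub>E\<^esub> z" by (simp only: comm)
  also have "\<dots> = \<one>\<^bsub>E\<^esub>" using x z by (simp add: E.inv_mult_group E.m_assoc)
  finally show ?thesis .
qed

text \<open>With \<open>s\<close> false, the closure of \<open>H\<close> contains the conjugate of \<open>b\<close> by \<open>t c t\<inverse>\<close>, so \<open>z\<close> commutes with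
  it; but their commutator has a reduced form with eight letters.\<close>

lemma closure_excludes_if_centralized:
  assumes b: "b \<in> carrier B" "b \<notin> assoc s" "base b \<in> closure (assoc s)"
    and c: "c \<in> carrier B" "c \<notin> assoc (\<not> s)"
    and z: "z \<in> carrier B" "z \<notin> assoc s" "\<And>h. h \<in> assoc s \<Longrightarrow> z \<otimes> h = h \<otimes> z"
  shows False
proof -
  let ?x = "bent s (inv c) \<otimes>\<^bsub>E\<^esub> base b \<otimes>\<^bsub>E\<^esub> bent s c"
  have sub: "assoc s \<subseteq> carrier B" using assoc_closed by blast
  have x: "?x \<in> carrier E" using b c by (simp add: bent_closed base_closed)
  have ic: "inv c \<in> carrier B" using c(1) by simp
  have "?x \<in> closure (assoc s)"
    using closure_conj[OF sub b(3) normalizes_bent[OF ic]]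
    by (simp only: inv_bent[OF ic] inv_inv[OF c(1)])
  moreover have "base z \<otimes>\<^bsub>E\<^esub> base h = base h \<otimes>\<^bsub>E\<^esub> base z" if "h \<in> assoc s" for h
    using z(3)[OF that] base_mult[OF z(1) assoc_closed[OF that]] base_mult[OF assoc_closed[OF that] z(1)]
    by (simp only:)
  ultimately have eq: "base z \<otimes>\<^bsub>E\<^esub> ?x = ?x \<otimes>\<^bsub>E\<^esub> base z"
    by (rule closure_commute[OF sub _ base_closed[OF z(1)]])
  have "?x \<otimes>\<^bsub>E\<^esub> base (inv z) \<otimes>\<^bsub>E\<^esub> inv\<^bsub>E\<^esub> ?x \<otimes>\<^bsub>E\<^esub> base z = \<one>\<^bsub>E\<^esub>"
    unfolding base.hom_inv[OF z(1)] by (rule commutator_one[OF x base_closed[OF z(1)] eq])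
  moreover have "path [(\<not> s, inv c), (s, b), (\<not> s, c), (s, inv z), (\<not> s, inv c), (s, inv b), (\<not> s, c), (s, z)]
      = ?x \<otimes>\<^bsub>E\<^esub> base (inv z) \<otimes>\<^bsub>E\<^esub> inv\<^bsub>E\<^esub> ?x \<otimes>\<^bsub>E\<^esub> base z"
    using b(1) c(1) z(1) by (simp add: E.inv_mult_group bent_closed base_closed inv_bent)
      (simp add: bent_def letter_closed base_closed E.m_assoc)
  moreover have "reduced [(\<not> s, inv c), (s, b), (\<not> s, c), (s, inv z), (\<not> s, inv c), (s, inv b), (\<not> s, c), (s, z)]"
    using b(1,2) c z(1,2) assoc_inv_iff by (simp add: reduced_Cons reduced_def)
  ultimately show False using britton by (metis list.distinct(1))
qed

lemma induced_commute:
  assumes "induced s c d" and c: "c \<in> carrier B" and d: "d \<in> carrier B" and h: "h \<in> assoc s"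
  shows "(bent s c \<otimes>\<^bsub>E\<^esub> base (inv d)) \<otimes>\<^bsub>E\<^esub> base h = base h \<otimes>\<^bsub>E\<^esub> (bent s c \<otimes>\<^bsub>E\<^esub> base (inv d))"
proof -
  have hB: "h \<in> carrier B" using assoc_closed[OF h] .
  have th: "twist s h \<in> carrier B" using assoc_closed[OF twist_closed[OF h]] .
  have h': "inv d \<otimes> h \<otimes> d \<in> assoc s" by (rule assoc_conj(2)[OF h d])
  have "c \<otimes> (inv c \<otimes> twist s h \<otimes> c) \<otimes> inv c = (c \<otimes> inv c) \<otimes> twist s h \<otimes> (c \<otimes> inv c)"
    using c th by (simp only: m_assoc m_closed inv_closed)
  then have "bent s c \<otimes>\<^bsub>E\<^esub> base (inv d \<otimes> h \<otimes> d) \<otimes>\<^bsub>E\<^esub> inv\<^bsub>E\<^esub> (bent s c) = base h"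
    using bent_conj[OF h' c] assms(1) h c th by (simp add: induced_def)
  then have "base h \<otimes>\<^bsub>E\<^esub> bent s c = bent s c \<otimes>\<^bsub>E\<^esub> base (inv d \<otimes> h \<otimes> d)"
    using bent_closed[OF c, of s] hB d by (metis E.inv_solve_right base_closed inv_closed m_closed E.m_closed)
  then have "base h \<otimes>\<^bsub>E\<^esub> (bent s c \<otimes>\<^bsub>E\<^esub> base (inv d)) = bent s c \<otimes>\<^bsub>E\<^esub> (base (inv d \<otimes> h \<otimes> d) \<otimes>\<^bsub>E\<^esub> base (inv d))"
    using bent_closed[OF c, of s] hB d by (metis E.m_assoc base_closed inv_closed m_closed)
  also have "base (inv d \<otimes> h \<otimes> d) \<otimes>\<^bsub>E\<^esub> base (inv d) = base (inv d) \<otimes>\<^bsub>E\<^esub> base h"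
    using hB d by (simp add: base_closed E.m_assoc)
  finally show ?thesis
    using bent_closed[OF c, of s] hB d by (simp add: E.m_assoc base_closed del: base.hom_mult)
qed

text \<open>An element \<open>t c t\<inverse> d\<inverse>\<close> that centralizes \<open>H\<close> would commute with \<open>b\<close>, so \<open>c\<close> must lie in \<open>K\<close> whenever
  \<open>c\<close> and \<open>d\<close> induce the same automorphism.  This refutes the first alternative.  In the second one
  take \<open>d = b\<close>; then \<open>t c t\<inverse>\<close> is an element \<open>a\<close> of \<open>H\<close>, and \<open>a b\<inverse>\<close> is an element of \<open>B\<close> outside \<open>H\<close>
  that centralizes \<open>H\<close>.\<close>

lemma closure_excludes_if_induced:
  assumes b: "b \<in> carrier B" "b \<notin> assoc s" "base b \<in> closure (assoc s)"
    and ind: "(\<forall>c \<in> carrier B. \<exists>d \<in> carrier B. induced s c d) \<or> (\<forall>d \<in> carrier B. \<exists>c \<in> carrier B. induced s c d)"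
  shows False
proof -
  have sub: "assoc s \<subseteq> carrier B" using assoc_closed by blast
  obtain c0 where c0: "c0 \<in> carrier B" "c0 \<notin> assoc (\<not> s)" using assoc_proper[OF b(1,2)] .
  have inside: "c \<in> assoc (\<not> s)" if cd: "c \<in> carrier B" "d \<in> carrier B" "induced s c d" for c d
  proof (rule ccontr)
    assume c: "c \<notin> assoc (\<not> s)"
    have "bent s c \<otimes>\<^bsub>E\<^esub> base (inv d) \<in> carrier E"
      using cd by (intro E.m_closed bent_closed base_closed inv_closed)
    then have "(bent s c \<otimes>\<^bsub>E\<^esub> base (inv d)) \<otimes>\<^bsub>E\<^esub> base b = base b \<otimes>\<^bsub>E\<^esub> (bent s c \<otimes>\<^bsub>E\<^esub> base (inv d))"
      by (rule closure_commute[OF sub b(3)]) (rule induced_commute[OF cd(3,1,2)])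
    then show False using bent_not_commute[OF b(1,2) cd(1) c cd(2)] by (rule notE[rotated])
  qed
  from ind show False
  proof
    assume "\<forall>c \<in> carrier B. \<exists>d \<in> carrier B. induced s c d"
    then show False using inside c0 by blast
  next
    assume "\<forall>d \<in> carrier B. \<exists>c \<in> carrier B. induced s c d"
    then obtain c where c: "c \<in> carrier B" "induced s c b" using b(1) by blast
    then have cA: "c \<in> assoc (\<not> s)" using inside b(1) by blast
    define a where "a = twist (\<not> s) c"
    have a: "a \<in> assoc s" "twist s a = c" using twist_closed[OF cA] cA by (simp_all add: a_def)
    have aB: "a \<in> carrier B" using assoc_closed[OF a(1)] .
    have "(a \<otimes> inv b) \<otimes> h = h \<otimes> (a \<otimes> inv b)" if h: "h \<in> assoc s" for h
    proof -
      have hB: "h \<in> carrier B" using assoc_closed[OF h] .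
      have "inv c = twist s (inv a)"
      proof -
        have "twist s (inv a) \<otimes> c = \<one>"
          using twist_mult[of "inv a" s a] a aB by simp
        then show ?thesis
          using c(1) assoc_closed[OF twist_closed[OF assoc_inv[OF a(1)]]] by (intro inv_equality)
      qed
      moreover have "twist s (inv a \<otimes> h \<otimes> a) = twist s (inv a) \<otimes> twist s h \<otimes> twist s a"
        using h a(1) by simp
      moreover have "twist s (inv b \<otimes> h \<otimes> b) = inv c \<otimes> twist s h \<otimes> c"
        using c(2) h unfolding induced_def by blast
      ultimately have "twist s (inv b \<otimes> h \<otimes> b) = twist s (inv a \<otimes> h \<otimes> a)"
        by (simp only: a(2))
      then have "twist (\<not> s) (twist s (inv b \<otimes> h \<otimes> b)) = twist (\<not> s) (twist s (inv a \<otimes> h \<otimes> a))"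
        by (simp only:)
      then have "inv b \<otimes> h \<otimes> b = inv a \<otimes> h \<otimes> a"
        unfolding twist_twist[OF assoc_conj(2)[OF h b(1)]] twist_twist[OF assoc_conj(2)[OF h aB]] .
      then have eq: "a \<otimes> (inv b \<otimes> h \<otimes> b) \<otimes> inv b = a \<otimes> (inv a \<otimes> h \<otimes> a) \<otimes> inv b"
        by (simp only:)
      have "(a \<otimes> inv b) \<otimes> h = (a \<otimes> inv b) \<otimes> h \<otimes> (b \<otimes> inv b)"
        using aB hB b(1) by simp
      also have "\<dots> = a \<otimes> (inv b \<otimes> h \<otimes> b) \<otimes> inv b"
        using aB hB b(1) by (simp only: m_assoc m_closed inv_closed)
      also have "\<dots> = (a \<otimes> inv a) \<otimes> h \<otimes> (a \<otimes> inv b)"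
        unfolding eq using aB hB b(1) by (simp only: m_assoc m_closed inv_closed)
      also have "\<dots> = h \<otimes> (a \<otimes> inv b)"
        using aB hB b(1) by simp
      finally show ?thesis .
    qed
    moreover have "a \<otimes> inv b \<notin> assoc s"
      using assoc_mult_left_iff[OF a(1), of "inv b"] assoc_inv_iff b by simp
    ultimately show False
      by (intro closure_excludes_if_centralized[OF b c0, of "a \<otimes> inv b"] m_closed inv_closed aB b(1))
  qed
qed

text \<open>The conjugates of \<open>b\<close> by elements normalizing \<open>S\<close> lie in the closure of \<open>S\<close>, which satisfies every
  identity of \<open>S\<close>.\<close>

lemma closure_excludes_if_identity:
  assumes S: "subgroup S B" and ident: "satisfies_nontrivial_identity (B\<lparr>carrier := S\<rparr>)"
    and b: "b \<in> carrier B" "b \<notin> assoc s" "base b \<in> closure S"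
    and g: "normalizes S g" and q: "normalizes S q"
    and links_pos: "\<And>m. links s (inv\<^bsub>E\<^esub> q \<otimes>\<^bsub>E\<^esub> g [^]\<^bsub>E\<^esub> Suc m \<otimes>\<^bsub>E\<^esub> q)"
    and links_neg: "\<And>m. links s (inv\<^bsub>E\<^esub> q \<otimes>\<^bsub>E\<^esub> (inv\<^bsub>E\<^esub> g) [^]\<^bsub>E\<^esub> Suc m \<otimes>\<^bsub>E\<^esub> q)"
  shows False
proof -
  have sub: "S \<subseteq> carrier B" by (rule subgroup.subset[OF S])
  have base_sub: "subgroup (base ` S) E" by (rule base.subgroup_img_is_subgroup[OF S])
  have c: "g \<in> carrier E" "q \<in> carrier E" using g q by (simp_all add: normalizes_def)
  interpret S: group "B\<lparr>carrier := S\<rparr>" by (rule subgroup_imp_group[OF S])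
  have "base \<in> hom (B\<lparr>carrier := S\<rparr>) E"
    by (rule homI) (use subsetD[OF sub] in \<open>simp_all add: base_closed\<close>)
  then interpret base_S: group_hom "B\<lparr>carrier := S\<rparr>" E base
    by unfold_locales
  obtain w where w: "freely_reduced w" "w \<noteq> []"
    "\<And>k. k \<in> UNIV \<rightarrow> S \<Longrightarrow> word_value (B\<lparr>carrier := S\<rparr>) k w = \<one>"
    using ident by (auto simp: satisfies_nontrivial_identity_def)
  have w_base: "word_value E h w = \<one>\<^bsub>E\<^esub>" if h: "h \<in> UNIV \<rightarrow> base ` S" for h
  proof -
    have "\<forall>i. \<exists>k \<in> S. h i = base k" using h by auto
    then obtain k where k: "\<And>i. k i \<in> S" "\<And>i. h i = base (k i)" by metis
    have "word_value E (\<lambda>i. base (k i)) w = base (word_value (B\<lparr>carrier := S\<rparr>) k w)"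
      by (rule base_S.word_value_hom) (use k(1) in auto)
    also have "\<dots> = \<one>\<^bsub>E\<^esub>" using w(3)[of k] k(1) by simp
    finally show ?thesis using k(2) by (simp add: ext[of h "\<lambda>i. base (k i)"])
  qed
  have "spread_conj g q b i \<in> closure S" for i
    unfolding spread_conj_def
    by (rule closure_conj[OF sub b(3) normalizes_mult[OF sub normalizes_pow[OF sub g] q]])
  then have "spread_conj g q b i \<otimes>\<^bsub>E\<^esub> spread_conj g q b j \<in> closure S" for i j
    unfolding closure_def by (intro pro_closure_mult[OF \<C>_group group_E base_sub])
  then have "word_value E (\<lambda>i. spread_conj g q b (2 * i) \<otimes>\<^bsub>E\<^esub> spread_conj g q b (2 * i + 1)) w = \<one>\<^bsub>E\<^esub>"
    by (intro pro_closure_word_value[OF \<C>_group residually_E group_E subgroup.subset[OF base_sub] _ w_base])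
      (simp_all add: closure_def)
  then show False
    using spread_conj_no_identity[OF c b(1,2) links_pos links_neg w(1,2)] by (rule notE[rotated])
qed

lemma path_replicate:
  "path (replicate m (e, \<one>)) = letter e [^]\<^bsub>E\<^esub> m"
proof (induction m)
  case (Suc m)
  then show ?case
    unfolding E.nat_pow_Suc2[OF letter_closed] by (simp add: letter_closed)
qed simp

text \<open>Here \<open>y\<^sub>i = t\<^sup>i a t\<inverse>\<close> for \<open>s\<close> false.  All these elements normalize \<open>H \<inter> K\<close>, and
  \<open>y\<^sub>i\<inverse> y\<^sub>j = t a\<inverse> t\<^bsup>j - i\<^esup> a t\<inverse>\<close> is reduced for either sign of the exponent.\<close>

lemma core_closure_excludes:
  assumes ident: "satisfies_nontrivial_identity (B\<lparr>carrier := H \<inter> K\<rparr>)"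
    and b: "b \<in> carrier B" "b \<notin> assoc s" "base b \<in> closure (H \<inter> K)"
    and a: "a \<in> carrier B" "a \<notin> assoc (\<not> s)"
  shows False
proof -
  have core: "subgroup (H \<inter> K) B" "(H \<inter> K) \<lhd> B"
    using normal_subgroup_intersect[OF normal_H normal_K] normal_imp_subgroup by blast+
  let ?t = "letter (\<not> s)"
  let ?q = "base a \<otimes>\<^bsub>E\<^esub> letter s"
  have q: "?q \<in> carrier E" using a by (simp add: base_closed letter_closed)
  have inv_q: "inv\<^bsub>E\<^esub> ?q = ?t \<otimes>\<^bsub>E\<^esub> base (inv a)"
    using a by (simp add: E.inv_mult_group base_closed letter_closed inv_letter)
  have links: "links s (inv\<^bsub>E\<^esub> ?q \<otimes>\<^bsub>E\<^esub> letter e [^]\<^bsub>E\<^esub> Suc m \<otimes>\<^bsub>E\<^esub> ?q)" for e m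
  proof (rule linksI)
    let ?l = "(\<not> s, inv a) # replicate m (e, \<one>) @ [(e, a)]"
    have hd: "fst (hd (replicate m (e, \<one>) @ [(e, a), (s, \<one>)])) = e" by (cases m) auto
    have "reduced (replicate m (e, \<one>) @ [(e, a), (s, \<one>)])"
    proof (induction m)
      case 0
      then show ?case using a by (cases "e = s") (auto simp: reduced_Cons reduced_def)
    next
      case (Suc m)
      have "fst (hd (replicate m (e, \<one>) @ [(e, a), (s, \<one>)])) = e" by (cases m) auto
      then show ?case using Suc by (simp add: reduced_Cons)
    qed
    then show "reduced (?l @ [(s, \<one>)])"
      using a assoc_inv_iff hd by (simp add: reduced_Cons)
    have "path ?l = ?t \<otimes>\<^bsub>E\<^esub> (base (inv a) \<otimes>\<^bsub>E\<^esub> (letter e [^]\<^bsub>E\<^esub> m \<otimes>\<^bsub>E\<^esub> (letter e \<otimes>\<^bsub>E\<^esub> base a)))"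
      using a by (subst path.simps, subst path_append) (auto simp: path_replicate base_closed)
    then show "inv\<^bsub>E\<^esub> ?q \<otimes>\<^bsub>E\<^esub> letter e [^]\<^bsub>E\<^esub> Suc m \<otimes>\<^bsub>E\<^esub> ?q = path ?l \<otimes>\<^bsub>E\<^esub> letter s"
      unfolding inv_q using a by (simp add: base_closed letter_closed E.nat_pow_closed E.m_assoc)
  qed simp_all
  have norm: "normalizes (H \<inter> K) ?t" "normalizes (H \<inter> K) ?q"
    using normalizes_letter_core normalizes_mult[OF subgroup.subset[OF core(1)]] normalizes_base[OF core(2) a(1)] by blast+
  show False
  proof (rule closure_excludes_if_identity[OF core(1) ident b norm links])
    show "links s (inv\<^bsub>E\<^esub> ?q \<otimes>\<^bsub>E\<^esub> (inv\<^bsub>E\<^esub> ?t) [^]\<^bsub>E\<^esub> Suc m \<otimes>\<^bsub>E\<^esub> ?q)" for m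
      unfolding inv_letter by (rule links)
  qed
qed

text \<open>For \<open>s\<close> false, the reduced form of \<open>(t c t\<inverse> d)\<^sup>m\<close>.\<close>

fun zigzag :: "bool \<Rightarrow> 'b \<Rightarrow> 'b \<Rightarrow> nat \<Rightarrow> (bool \<times> 'b) list" where
  "zigzag s c d 0 = []"
| "zigzag s c d (Suc m) = (\<not> s, c) # (s, d) # zigzag s c d m"

lemma zigzag_closed: "\<lbrakk>c \<in> carrier B; d \<in> carrier B\<rbrakk> \<Longrightarrow> snd ` set (zigzag s c d m) \<subseteq> carrier B"
  by (induction m) auto

lemma path_zigzag:
  assumes "c \<in> carrier B" and "d \<in> carrier B"
  shows "path (zigzag s c d m) = (bent s c \<otimes>\<^bsub>E\<^esub> base d) [^]\<^bsub>E\<^esub> m"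
proof (induction m)
  case (Suc m)
  have "bent s c \<otimes>\<^bsub>E\<^esub> base d \<in> carrier E" using assms by (simp add: bent_closed base_closed)
  then have "(bent s c \<otimes>\<^bsub>E\<^esub> base d) [^]\<^bsub>E\<^esub> Suc m = (bent s c \<otimes>\<^bsub>E\<^esub> base d) \<otimes>\<^bsub>E\<^esub> path (zigzag s c d m)"
    unfolding Suc by (rule E.nat_pow_Suc2)
  also have "\<dots> = path (zigzag s c d (Suc m))"
    using assms path_closed[OF zigzag_closed[OF assms, of s m]]
    by (simp add: bent_def base_closed letter_closed E.m_assoc)
  finally show ?case by (rule HOL.sym)
qed simp

lemma links_zigzag:
  assumes c: "c \<in> carrier B" "c \<notin> assoc (\<not> s)" and d: "d \<in> carrier B" "d \<notin> assoc s"
    and x: "x \<in> carrier B" "x \<notin> assoc (\<not> s)" and y: "y \<in> carrier B" "y \<notin> assoc (\<not> s)"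
  shows "links s (bent s x \<otimes>\<^bsub>E\<^esub> base d \<otimes>\<^bsub>E\<^esub> (bent s c \<otimes>\<^bsub>E\<^esub> base d) [^]\<^bsub>E\<^esub> (m::nat) \<otimes>\<^bsub>E\<^esub> bent s y)"
proof (rule linksI)
  let ?l = "(\<not> s, x) # (s, d) # zigzag s c d m @ [(\<not> s, y)]"
  have hd: "fst (hd (zigzag s c d m @ [(\<not> s, y), (s, \<one>)])) = (\<not> s)" for m by (cases m) auto
  have "reduced (zigzag s c d m @ [(\<not> s, y), (s, \<one>)])"
  proof (induction m)
    case 0
    then show ?case using y by (simp add: reduced_Cons reduced_def)
  next
    case (Suc m)
    then show ?case using hd[of m] c d by (simp add: reduced_Cons)
  qed
  then show "reduced (?l @ [(s, \<one>)])"
    using hd[of m] x d by (simp add: reduced_Cons)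
  show "bent s x \<otimes>\<^bsub>E\<^esub> base d \<otimes>\<^bsub>E\<^esub> (bent s c \<otimes>\<^bsub>E\<^esub> base d) [^]\<^bsub>E\<^esub> m \<otimes>\<^bsub>E\<^esub> bent s y = path ?l \<otimes>\<^bsub>E\<^esub> letter s"
    using x(1) y(1) d(1) path_closed[OF zigzag_closed[OF c(1) d(1), of s m]] zigzag_closed[OF c(1) d(1), of s m]
    unfolding path_zigzag[OF c(1) d(1), of s m, symmetric]
    by (simp add: path_append bent_def base_closed letter_closed E.m_assoc)
qed simp_all

lemma pow_shift:
  assumes "x \<in> carrier E" and "y \<in> carrier E"
  shows "(x \<otimes>\<^bsub>E\<^esub> y) [^]\<^bsub>E\<^esub> Suc m = x \<otimes>\<^bsub>E\<^esub> (y \<otimes>\<^bsub>E\<^esub> x) [^]\<^bsub>E\<^esub> (m::nat) \<otimes>\<^bsub>E\<^esub> y"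
proof (induction m)
  case (Suc m)
  have "(x \<otimes>\<^bsub>E\<^esub> y) [^]\<^bsub>E\<^esub> Suc (Suc m) = (x \<otimes>\<^bsub>E\<^esub> (y \<otimes>\<^bsub>E\<^esub> x) [^]\<^bsub>E\<^esub> m \<otimes>\<^bsub>E\<^esub> y) \<otimes>\<^bsub>E\<^esub> (x \<otimes>\<^bsub>E\<^esub> y)"
    using Suc E.nat_pow_Suc[of "x \<otimes>\<^bsub>E\<^esub> y" "Suc m"] by (simp only:)
  also have "\<dots> = x \<otimes>\<^bsub>E\<^esub> ((y \<otimes>\<^bsub>E\<^esub> x) [^]\<^bsub>E\<^esub> m \<otimes>\<^bsub>E\<^esub> (y \<otimes>\<^bsub>E\<^esub> x)) \<otimes>\<^bsub>E\<^esub> y"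
    using assms by (simp only: E.m_assoc E.m_closed E.nat_pow_closed)
  finally show ?case by (simp only: E.nat_pow_Suc)
qed (use assms in simp)

lemma bent_bent:
  "\<lbrakk>c \<in> carrier B; d \<in> carrier B\<rbrakk> \<Longrightarrow> bent s c \<otimes>\<^bsub>E\<^esub> bent s d = bent s (c \<otimes> d)"
  by (simp add: bent_def base_closed letter_closed E.m_assoc letter_letter_left)

text \<open>Here \<open>y\<^sub>i = (t c t\<inverse> b)\<^sup>i t d t\<inverse>\<close> for \<open>s\<close> false.  The products \<open>d\<inverse> c\<close> and \<open>c\<inverse> d\<close> appear at the two
  ends of \<open>y\<^sub>i\<inverse> y\<^sub>j\<close>, for \<open>i < j\<close> and for \<open>i > j\<close> respectively, and must lie outside \<open>assoc (\<not> s)\<close>.\<close>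

lemma closure_excludes_if_three_cosets:
  assumes ident: "satisfies_nontrivial_identity (B\<lparr>carrier := assoc s\<rparr>)"
    and b: "b \<in> carrier B" "b \<notin> assoc s" "base b \<in> closure (assoc s)"
    and c: "c \<in> carrier B" "c \<notin> assoc (\<not> s)"
    and d: "d \<in> carrier B" "d \<notin> assoc (\<not> s)"
    and cd: "inv c \<otimes> d \<notin> assoc (\<not> s)"
  shows False
proof -
  let ?g = "bent s c \<otimes>\<^bsub>E\<^esub> base b"
  let ?q = "bent s d"
  have dc: "inv d \<otimes> c \<notin> assoc (\<not> s)"
    using assoc_inv_iff[of "inv c \<otimes> d" "\<not> s"] cd c d by (simp add: inv_mult_group)
  have closed: "bent s c \<in> carrier E" "?q \<in> carrier E" "bent s (inv d) \<in> carrier E" "bent s (inv c) \<in> carrier E"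
      "base b \<in> carrier E" "base (inv b) \<in> carrier E"
    using b c d by (simp_all only: bent_closed base_closed inv_closed)
  have "normalizes (assoc s) ?g" "normalizes (assoc s) ?q"
    using normalizes_bent c(1) d(1) normalizes_base[OF normal_assoc b(1)]
      normalizes_mult[OF subgroup.subset[OF subgroup_assoc]] by blast+
  then show False
  proof (rule closure_excludes_if_identity[OF subgroup_assoc ident b])
    fix m
    have "inv\<^bsub>E\<^esub> ?q \<otimes>\<^bsub>E\<^esub> ?g [^]\<^bsub>E\<^esub> Suc m \<otimes>\<^bsub>E\<^esub> ?q
        = (bent s (inv d) \<otimes>\<^bsub>E\<^esub> bent s c) \<otimes>\<^bsub>E\<^esub> base b \<otimes>\<^bsub>E\<^esub> ?g [^]\<^bsub>E\<^esub> m \<otimes>\<^bsub>E\<^esub> ?q"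
      unfolding inv_bent[OF d(1)] E.nat_pow_Suc2[OF E.m_closed[OF closed(1,5)]]
      using closed by (simp only: E.m_assoc E.m_closed E.nat_pow_closed)
    also have "\<dots> = bent s (inv d \<otimes> c) \<otimes>\<^bsub>E\<^esub> base b \<otimes>\<^bsub>E\<^esub> ?g [^]\<^bsub>E\<^esub> m \<otimes>\<^bsub>E\<^esub> ?q"
      using c d by (simp only: bent_bent inv_closed)
    finally show "links s (inv\<^bsub>E\<^esub> ?q \<otimes>\<^bsub>E\<^esub> ?g [^]\<^bsub>E\<^esub> Suc m \<otimes>\<^bsub>E\<^esub> ?q)"
      using links_zigzag[OF c b(1,2) _ dc d, of m] c(1) d(1) by (simp only: m_closed inv_closed)
    let ?h = "bent s (inv c) \<otimes>\<^bsub>E\<^esub> base (inv b)"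
    have "inv\<^bsub>E\<^esub> ?g = base (inv b) \<otimes>\<^bsub>E\<^esub> bent s (inv c)"
      using closed b c by (simp add: E.inv_mult_group inv_bent)
    then have "inv\<^bsub>E\<^esub> ?q \<otimes>\<^bsub>E\<^esub> (inv\<^bsub>E\<^esub> ?g) [^]\<^bsub>E\<^esub> Suc m \<otimes>\<^bsub>E\<^esub> ?q
        = bent s (inv d) \<otimes>\<^bsub>E\<^esub> (base (inv b) \<otimes>\<^bsub>E\<^esub> ?h [^]\<^bsub>E\<^esub> m \<otimes>\<^bsub>E\<^esub> bent s (inv c)) \<otimes>\<^bsub>E\<^esub> ?q"
      using pow_shift[OF closed(6,4), of m] inv_bent[OF d(1)] by (simp only:)
    also have "\<dots> = bent s (inv d) \<otimes>\<^bsub>E\<^esub> base (inv b) \<otimes>\<^bsub>E\<^esub> ?h [^]\<^bsub>E\<^esub> m \<otimes>\<^bsub>E\<^esub> (bent s (inv c) \<otimes>\<^bsub>E\<^esub> ?q)"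
      using closed by (simp only: E.m_assoc E.m_closed E.nat_pow_closed)
    also have "\<dots> = bent s (inv d) \<otimes>\<^bsub>E\<^esub> base (inv b) \<otimes>\<^bsub>E\<^esub> ?h [^]\<^bsub>E\<^esub> m \<otimes>\<^bsub>E\<^esub> bent s (inv c \<otimes> d)"
      using c d by (simp only: bent_bent inv_closed)
    finally show "links s (inv\<^bsub>E\<^esub> ?q \<otimes>\<^bsub>E\<^esub> (inv\<^bsub>E\<^esub> ?g) [^]\<^bsub>E\<^esub> Suc m \<otimes>\<^bsub>E\<^esub> ?q)"
      using links_zigzag[of "inv c" s "inv b" "inv d" "inv c \<otimes> d" m] b c d cd
      by (simp only: m_closed inv_closed assoc_inv_iff not_False_eq_True simp_thms)
  qed
qed

text \<open>Let \<open>A = assoc s\<close> and \<open>A' = assoc (\<not> s)\<close>.  If \<open>b\<close> is in the closure of \<open>A\<close>, the lemmas above leave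
  only the case that \<open>A\<close> is not contained in \<open>A'\<close> and every element of \<open>B\<close> lies in \<open>A A'\<close>: any other
  element of \<open>B\<close>, combined with an element of \<open>A\<close> outside \<open>A'\<close>, would give three cosets of \<open>A'\<close>.
  The required quotient then comes from one of \<open>A' / (A \<inter> A')\<close>.\<close>

lemma separated_quotient:
  assumes sep: "satisfies_nontrivial_identity (B\<lparr>carrier := assoc s\<rparr>)
      \<or> (\<forall>c \<in> carrier B. \<exists>d \<in> carrier B. induced s c d)
      \<or> (\<forall>d \<in> carrier B. \<exists>c \<in> carrier B. induced s c d)"
    and b: "b \<in> carrier B" "b \<notin> assoc s"
  shows "\<exists>Y f. \<C> Y \<and> f \<in> epi B Y \<and> (\<forall>n \<in> assoc s. f n = \<one>\<^bsub>Y\<^esub>) \<and> f b \<noteq> \<one>\<^bsub>Y\<^esub>"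
proof (cases "base b \<in> closure (assoc s)")
  case False
  then obtain X f where X: "\<C> X" "f \<in> epi E X" "f (base b) \<notin> f ` base ` assoc s"
    using base_closed[OF b(1)] by (auto simp: closure_def pro_closure_def)
  have "f \<circ> base \<in> hom B X"
    using X(2) by (intro Group.hom_compose[OF base_hom]) (simp add: epi_iff_subset)
  moreover have "(f \<circ> base) b \<notin> (f \<circ> base) ` assoc s"
    using X(3) by (simp add: image_comp)
  ultimately show ?thesis
    by (rule separating_quotient[OF \<C>_group \<C>_sub \<C>_quot X(1) group_axioms _ normal_assoc b(1)])
next
  case closure: True
  have ident: "satisfies_nontrivial_identity (B\<lparr>carrier := assoc s\<rparr>)"
    using sep closure_excludes_if_induced[OF b closure] by blast
  have core_ident: "satisfies_nontrivial_identity (B\<lparr>carrier := H \<inter> K\<rparr>)"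
  proof (rule identity_pullback[OF _ _ _ _ ident])
    show "group (B\<lparr>carrier := H \<inter> K\<rparr>)" "group (B\<lparr>carrier := assoc s\<rparr>)"
      using subgroup_imp_group subgroups_Inter_pair[OF subgroup_H subgroup_K] subgroup_assoc by blast+
    show "(\<lambda>x. x) \<in> hom (B\<lparr>carrier := H \<inter> K\<rparr>) (B\<lparr>carrier := assoc s\<rparr>)"
      using core_eq[of s] by (auto simp: hom_def)
  qed simp
  obtain a where a: "a \<in> carrier B" "a \<notin> assoc (\<not> s)"
    using assoc_proper[OF b] .
  show ?thesis
  proof (cases "assoc s \<subseteq> assoc (\<not> s)")
    case True
    then have "assoc s = H \<inter> K" using core_eq[of s] by blast
    then show ?thesis using core_closure_excludes[OF core_ident b _ a] closure by simp
  next
    case False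
    then obtain c where c: "c \<in> assoc s" "c \<in> carrier B" "c \<notin> assoc (\<not> s)" using assoc_closed by blast
    have prod: "\<exists>k \<in> assoc (\<not> s). x \<otimes> inv k \<in> assoc s" if x: "x \<in> carrier B" for x
    proof (rule ccontr)
      assume no: "\<not> (\<exists>k \<in> assoc (\<not> s). x \<otimes> inv k \<in> assoc s)"
      have "x \<notin> assoc (\<not> s)" using no x by force
      moreover have "inv c \<otimes> x \<notin> assoc (\<not> s)"
      proof
        assume k: "inv c \<otimes> x \<in> assoc (\<not> s)"
        have "x \<otimes> inv (inv c \<otimes> x) = x \<otimes> (inv x \<otimes> c)" using x c by (simp add: inv_mult_group)
        also have "\<dots> = c" using x c by (simp add: m_assoc[symmetric])
        finally show False using no k c(1) by metis
      qed
      ultimately show False using closure_excludes_if_three_cosets[OF ident b closure c(2,3) x] by blast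
    qed
    obtain k where k: "k \<in> assoc (\<not> s)" "b \<otimes> inv k \<in> assoc s" using prod[OF b(1)] by blast
    have kB: "k \<in> carrier B" using assoc_closed[OF k(1)] .
    have bk: "b = (b \<otimes> inv k) \<otimes> k" using b(1) kB by (simp add: m_assoc)
    have ks: "k \<notin> assoc s" using b(2) bk k(2) assoc_mult by metis
    have "base k \<notin> closure (H \<inter> K)"
      using core_closure_excludes[OF core_ident kB ks _ a] by blast
    then obtain X f where X: "\<C> X" "f \<in> epi E X" "f (base k) \<notin> f ` base ` (H \<inter> K)"
      using base_closed[OF kB] by (auto simp: closure_def pro_closure_def)
    have "f \<circ> base \<in> hom B X"
      using X(2) by (intro Group.hom_compose[OF base_hom]) (simp add: epi_iff_subset)
    then have f_hom: "f \<circ> base \<in> hom (B\<lparr>carrier := assoc (\<not> s)\<rparr>) X"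
      using assoc_closed by (auto simp: hom_def)
    have core_normal: "H \<inter> K \<lhd> B\<lparr>carrier := assoc (\<not> s)\<rparr>"
      using normal_Int_subgroup[OF subgroup_assoc[of "\<not> s"] normal_assoc[of s]] core_eq[of s] by (simp add: Int_commute)
    have k_sep: "(f \<circ> base) k \<notin> (f \<circ> base) ` (H \<inter> K)"
      using X(3) by (simp add: image_comp)
    obtain Y h where Y: "\<C> Y" "h \<in> epi (B\<lparr>carrier := assoc (\<not> s)\<rparr>) Y" "\<forall>n \<in> H \<inter> K. h n = \<one>\<^bsub>Y\<^esub>" "h k \<noteq> \<one>\<^bsub>Y\<^esub>"
      using separating_quotient[OF \<C>_group \<C>_sub \<C>_quot X(1) subgroup_imp_group[OF subgroup_assoc] f_hom core_normal _ k_sep] k(1)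
      by auto
    have "h x = \<one>\<^bsub>Y\<^esub>" if "x \<in> assoc s \<inter> assoc (\<not> s)" for x using that Y(3) core_eq[of s] by blast
    then obtain h' where h': "h' \<in> epi B Y" "\<And>x. x \<in> assoc s \<Longrightarrow> h' x = \<one>\<^bsub>Y\<^esub>" "\<And>k. k \<in> assoc (\<not> s) \<Longrightarrow> h' k = h k"
      using extend_epi_along_complement[OF normal_assoc subgroup_assoc prod Y(2) group_class_group[OF \<C>_group Y(1)]] by blast
    interpret h': group_hom B Y h' by (rule epi_group_hom[OF \<C>_group Y(1) group_axioms h'(1)])
    have "h' ((b \<otimes> inv k) \<otimes> k) = h' (b \<otimes> inv k) \<otimes>\<^bsub>Y\<^esub> h' k"
      by (rule h'.hom_mult) (use b(1) kB in simp_all)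
    then have "h' b = h' k"
      using h'(2)[OF k(2)] kB bk by simp
    then have "h' b \<noteq> \<one>\<^bsub>Y\<^esub>" using Y(4) h'(3)[OF k(1)] by simp
    then show ?thesis using Y(1) h'(1,2) by blast
  qed
qed

end

section \<open>Groups of automorphisms\<close>

text \<open>The group \<^const>\<open>AutoGroup\<close> composes from right to left, so it receives left actions.\<close>

lemma action_hom_AutoGroup:
  assumes "group G" and "group X"
    and closed: "\<And>a x. \<lbrakk>a \<in> carrier G; x \<in> carrier X\<rbrakk> \<Longrightarrow> \<rho> a x \<in> carrier X"
    and one: "\<And>x. x \<in> carrier X \<Longrightarrow> \<rho> \<one>\<^bsub>G\<^esub> x = x"
    and mult: "\<And>a b x. \<lbrakk>a \<in> carrier G; b \<in> carrier G; x \<in> carrier X\<rbrakk>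
      \<Longrightarrow> \<rho> (a \<otimes>\<^bsub>G\<^esub> b) x = \<rho> a (\<rho> b x)"
    and hom: "\<And>a x y. \<lbrakk>a \<in> carrier G; x \<in> carrier X; y \<in> carrier X\<rbrakk>
      \<Longrightarrow> \<rho> a (x \<otimes>\<^bsub>X\<^esub> y) = \<rho> a x \<otimes>\<^bsub>X\<^esub> \<rho> a y"
  shows "(\<lambda>a. restrict (\<rho> a) (carrier X)) \<in> hom G (AutoGroup X)"
proof -
  interpret G: group G by fact
  interpret X: group X by fact
  have inverse: "\<rho> (inv\<^bsub>G\<^esub> a) (\<rho> a x) = x" "\<rho> a (\<rho> (inv\<^bsub>G\<^esub> a) x) = x"
    if "a \<in> carrier G" "x \<in> carrier X" for a x
    using that one mult[of "inv\<^bsub>G\<^esub> a" a x] mult[of a "inv\<^bsub>G\<^esub> a" x] by simp_all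
  have Bij: "restrict (\<rho> a) (carrier X) \<in> Bij (carrier X)" if a: "a \<in> carrier G" for a
  proof -
    have "bij_betw (restrict (\<rho> a) (carrier X)) (carrier X) (carrier X)"
      by (rule bij_betw_byWitness[where f' = "\<rho> (inv\<^bsub>G\<^esub> a)"]) (use a closed inverse in auto)
    then show ?thesis by (simp add: Bij_def)
  qed
  have auto: "restrict (\<rho> a) (carrier X) \<in> auto X" if a: "a \<in> carrier G" for a
    using a closed hom Bij[OF a] by (auto simp: auto_def hom_def)
  show ?thesis
  proof (rule homI)
    fix a b assume ab: "a \<in> carrier G" "b \<in> carrier G"
    have "restrict (\<rho> (a \<otimes>\<^bsub>G\<^esub> b)) (carrier X)
        = compose (carrier X) (restrict (\<rho> a) (carrier X)) (restrict (\<rho> b) (carrier X))"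
      using ab closed mult by (auto simp: compose_def fun_eq_iff)
    then show "restrict (\<rho> (a \<otimes>\<^bsub>G\<^esub> b)) (carrier X)
        = restrict (\<rho> a) (carrier X) \<otimes>\<^bsub>AutoGroup X\<^esub> restrict (\<rho> b) (carrier X)"
      using Bij ab by (simp add: AutoGroup_def BijGroup_def)
  qed (use auto in \<open>simp add: AutoGroup_def\<close>)
qed

context hnn_data
begin

lemma assoc_group: "group (B\<lparr>carrier := assoc e\<rparr>)"
  by (rule subgroup_imp_group[OF subgroup_assoc])

lemma conj_assoc_hom:
  assumes normal: "assoc e \<lhd> B"
  shows "(\<lambda>a. \<lambda>h \<in> assoc e. a \<otimes> h \<otimes> inv a) \<in> hom B (AutoGroup (B\<lparr>carrier := assoc e\<rparr>))"
proof -
  have "(\<lambda>a. restrict (\<lambda>h. a \<otimes> h \<otimes> inv a) (carrier (B\<lparr>carrier := assoc e\<rparr>)))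
      \<in> hom B (AutoGroup (B\<lparr>carrier := assoc e\<rparr>))"
  proof (rule action_hom_AutoGroup[OF group_axioms assoc_group])
    fix a x y assume a: "a \<in> carrier B"
      and "x \<in> carrier (B\<lparr>carrier := assoc e\<rparr>)" "y \<in> carrier (B\<lparr>carrier := assoc e\<rparr>)"
    then have xy: "x \<in> carrier B" "y \<in> carrier B" using assoc_closed by auto
    have "(a \<otimes> x \<otimes> inv a) \<otimes> (a \<otimes> y \<otimes> inv a) = a \<otimes> x \<otimes> (inv a \<otimes> a) \<otimes> y \<otimes> inv a"
      using a xy by (simp only: m_assoc m_closed inv_closed)
    then show "a \<otimes> (x \<otimes>\<^bsub>B\<lparr>carrier := assoc e\<rparr>\<^esub> y) \<otimes> inv a
        = (a \<otimes> x \<otimes> inv a) \<otimes>\<^bsub>B\<lparr>carrier := assoc e\<rparr>\<^esub> (a \<otimes> y \<otimes> inv a)"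
      using a xy by (simp add: m_assoc)
  next
    fix a x assume "a \<in> carrier B" "x \<in> carrier (B\<lparr>carrier := assoc e\<rparr>)"
    then show "a \<otimes> x \<otimes> inv a \<in> carrier (B\<lparr>carrier := assoc e\<rparr>)"
      using normal.inv_op_closed2[OF normal] by simp
  next
    fix a b x assume "a \<in> carrier B" "b \<in> carrier B" and "x \<in> carrier (B\<lparr>carrier := assoc e\<rparr>)"
    moreover from this have "x \<in> carrier B" using assoc_closed by simp
    ultimately show "a \<otimes> b \<otimes> x \<otimes> inv (a \<otimes> b) = a \<otimes> (b \<otimes> x \<otimes> inv b) \<otimes> inv a"
      by (simp add: inv_mult_group m_assoc)
  next
    fix x assume "x \<in> carrier (B\<lparr>carrier := assoc e\<rparr>)"
    then have "x \<in> carrier B" using assoc_closed by simp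
    then show "\<one> \<otimes> x \<otimes> inv \<one> = x" by simp
  qed
  then show ?thesis by simp
qed

lemma conj_pulled_hom:
  assumes normal: "assoc (\<not> e) \<lhd> B"
  shows "(\<lambda>a. \<lambda>h \<in> assoc e. twist (\<not> e) (a \<otimes> twist e h \<otimes> inv a))
    \<in> hom B (AutoGroup (B\<lparr>carrier := assoc e\<rparr>))"
proof -
  note conj = normal.inv_op_closed2[OF normal _ twist_closed]
  have tw: "twist e h \<in> carrier B" if "h \<in> assoc e" for h
    using assoc_closed[OF twist_closed[OF that]] .
  have "(\<lambda>a. restrict (\<lambda>h. twist (\<not> e) (a \<otimes> twist e h \<otimes> inv a)) (carrier (B\<lparr>carrier := assoc e\<rparr>)))
      \<in> hom B (AutoGroup (B\<lparr>carrier := assoc e\<rparr>))"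
  proof (rule action_hom_AutoGroup[OF group_axioms assoc_group])
    fix a x y assume a: "a \<in> carrier B"
      and "x \<in> carrier (B\<lparr>carrier := assoc e\<rparr>)" "y \<in> carrier (B\<lparr>carrier := assoc e\<rparr>)"
    then have xy: "x \<in> assoc e" "y \<in> assoc e" by simp_all
    have "a \<otimes> twist e (x \<otimes> y) \<otimes> inv a = a \<otimes> twist e x \<otimes> (inv a \<otimes> a) \<otimes> twist e y \<otimes> inv a"
      using a xy tw[OF xy(1)] tw[OF xy(2)] by (simp add: m_assoc)
    also have "\<dots> = (a \<otimes> twist e x \<otimes> inv a) \<otimes> (a \<otimes> twist e y \<otimes> inv a)"
      using a tw[OF xy(1)] tw[OF xy(2)] by (simp only: m_assoc m_closed inv_closed)
    finally show "twist (\<not> e) (a \<otimes> twist e (x \<otimes>\<^bsub>B\<lparr>carrier := assoc e\<rparr>\<^esub> y) \<otimes> inv a)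
        = twist (\<not> e) (a \<otimes> twist e x \<otimes> inv a) \<otimes>\<^bsub>B\<lparr>carrier := assoc e\<rparr>\<^esub> twist (\<not> e) (a \<otimes> twist e y \<otimes> inv a)"
      using conj[OF a xy(1)] conj[OF a xy(2)] twist_mult by simp
  next
    fix a x assume "a \<in> carrier B" "x \<in> carrier (B\<lparr>carrier := assoc e\<rparr>)"
    then show "twist (\<not> e) (a \<otimes> twist e x \<otimes> inv a) \<in> carrier (B\<lparr>carrier := assoc e\<rparr>)"
      using twist_closed[OF conj] by simp
  next
    fix a b x assume ab: "a \<in> carrier B" "b \<in> carrier B" and "x \<in> carrier (B\<lparr>carrier := assoc e\<rparr>)"
    then have x: "x \<in> assoc e" by simp
    have "twist e (twist (\<not> e) (b \<otimes> twist e x \<otimes> inv b)) = b \<otimes> twist e x \<otimes> inv b"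
      by (rule twist_twist'[OF conj[OF ab(2) x]])
    then show "twist (\<not> e) (a \<otimes> b \<otimes> twist e x \<otimes> inv (a \<otimes> b))
        = twist (\<not> e) (a \<otimes> twist e (twist (\<not> e) (b \<otimes> twist e x \<otimes> inv b)) \<otimes> inv a)"
      using ab tw[OF x] by (simp add: inv_mult_group m_assoc)
  next
    fix x assume "x \<in> carrier (B\<lparr>carrier := assoc e\<rparr>)"
    then have x: "x \<in> assoc e" by simp
    then show "twist (\<not> e) (\<one> \<otimes> twist e x \<otimes> inv \<one>) = x"
      using tw[OF x] by simp
  qed
  then show ?thesis by simp
qed

lemma image_inverse: "(\<lambda>x. f (inv x)) ` carrier B = f ` carrier B"
proof
  show "f ` carrier B \<subseteq> (\<lambda>x. f (inv x)) ` carrier B"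
  proof
    fix y assume "y \<in> f ` carrier B"
    then obtain x where "x \<in> carrier B" "y = f x" by blast
    then have "y = (\<lambda>x. f (inv x)) (inv x)" "inv x \<in> carrier B" by simp_all
    then show "y \<in> (\<lambda>x. f (inv x)) ` carrier B" by blast
  qed
qed auto

lemma Aut_in_eq: "Aut_in B H = (\<lambda>a. \<lambda>h \<in> assoc False. a \<otimes> h \<otimes> inv a) ` carrier B"
proof -
  have "Aut_in B H = (\<lambda>a. (\<lambda>b. \<lambda>h \<in> H. b \<otimes> h \<otimes> inv b) (inv a)) ` carrier B"
    unfolding Aut_in_def by (rule image_cong) simp_all
  also have "\<dots> = (\<lambda>b. \<lambda>h \<in> H. b \<otimes> h \<otimes> inv b) ` carrier B" by (rule image_inverse)
  finally show ?thesis by (simp add: assoc_def)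
qed

lemma Aut_pulled_eq:
  "Aut_pulled B H K \<phi> =
    (\<lambda>a. \<lambda>h \<in> assoc False. twist True (a \<otimes> twist False h \<otimes> inv a)) ` carrier B"
proof -
  have "\<phi> h \<in> K" if "h \<in> H" for h using bij_\<phi> that by (auto simp: bij_betw_def)
  then have "Aut_pulled B H K \<phi> = (\<lambda>a. (\<lambda>b. \<lambda>h \<in> H. inv_into H \<phi> (b \<otimes> \<phi> h \<otimes> inv b)) (inv a)) ` carrier B"
    unfolding Aut_pulled_def Aut_in_def image_image
    by (intro image_cong HOL.refl restrict_ext) simp
  also have "\<dots> = (\<lambda>b. \<lambda>h \<in> H. inv_into H \<phi> (b \<otimes> \<phi> h \<otimes> inv b)) ` carrier B" by (rule image_inverse)
  finally show ?thesis by (simp add: assoc_def twist_def)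
qed

lemma commute_if_conj_fixed:
  assumes a: "a \<in> carrier B" and x: "x \<in> carrier B" and fixed: "a \<otimes> x \<otimes> inv a = x"
  shows "a \<otimes> x = x \<otimes> a"
proof -
  have "a \<otimes> x = (a \<otimes> x \<otimes> inv a) \<otimes> a" using a x by (simp add: m_assoc)
  then show ?thesis by (simp only: fixed)
qed

lemma identity_H_if_Aut_in:
  assumes "H \<lhd> B"
    and "satisfies_nontrivial_identity ((AutoGroup (B\<lparr>carrier := H\<rparr>))\<lparr>carrier := Aut_in B H\<rparr>)"
  shows "satisfies_nontrivial_identity (B\<lparr>carrier := H\<rparr>)"
proof (rule identity_if_centralized[OF group_axioms])
  have H: "assoc False = H" by (simp add: assoc_def)
  show "group (AutoGroup (B\<lparr>carrier := H\<rparr>))"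
    by (rule group.AutoGroup[OF subgroup_imp_group[OF subgroup_H]])
  show "(\<lambda>a. \<lambda>h \<in> H. a \<otimes> h \<otimes> inv a) \<in> hom B (AutoGroup (B\<lparr>carrier := H\<rparr>))"
    using conj_assoc_hom[of False] assms(1) unfolding H .
  show "satisfies_nontrivial_identity ((AutoGroup (B\<lparr>carrier := H\<rparr>))
      \<lparr>carrier := (\<lambda>a. \<lambda>h \<in> H. a \<otimes> h \<otimes> inv a) ` carrier B\<rparr>)"
    using assms(2) unfolding Aut_in_eq H .
  fix a x assume a: "a \<in> carrier B" and one: "(\<lambda>h \<in> H. a \<otimes> h \<otimes> inv a) = \<one>\<^bsub>AutoGroup (B\<lparr>carrier := H\<rparr>)\<^esub>"
    and x: "x \<in> H"
  have xB: "x \<in> carrier B" using subgroup.mem_carrier[OF subgroup_H x] .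
  have "a \<otimes> x \<otimes> inv a = x"
    using fun_cong[OF one, of x] x by (simp add: AutoGroup_def BijGroup_def)
  then show "a \<otimes> x = x \<otimes> a" by (rule commute_if_conj_fixed[OF a xB])
qed (rule subgroup_H)

lemma identity_K_if_Aut_pulled:
  assumes "K \<lhd> B"
    and "satisfies_nontrivial_identity ((AutoGroup (B\<lparr>carrier := H\<rparr>))\<lparr>carrier := Aut_pulled B H K \<phi>\<rparr>)"
  shows "satisfies_nontrivial_identity (B\<lparr>carrier := K\<rparr>)"
proof (rule identity_if_centralized[OF group_axioms])
  let ?\<theta> = "\<lambda>a. \<lambda>h \<in> H. twist True (a \<otimes> twist False h \<otimes> inv a)"
  have H: "assoc False = H" and K: "assoc True = K" by (simp_all add: assoc_def)
  show "group (AutoGroup (B\<lparr>carrier := H\<rparr>))"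
    by (rule group.AutoGroup[OF subgroup_imp_group[OF subgroup_H]])
  show "?\<theta> \<in> hom B (AutoGroup (B\<lparr>carrier := H\<rparr>))"
    using conj_pulled_hom[of False] assms(1) by (simp add: H K)
  show "satisfies_nontrivial_identity ((AutoGroup (B\<lparr>carrier := H\<rparr>))\<lparr>carrier := ?\<theta> ` carrier B\<rparr>)"
    using assms(2) unfolding Aut_pulled_eq H .
  fix a k assume a: "a \<in> carrier B" and one: "?\<theta> a = \<one>\<^bsub>AutoGroup (B\<lparr>carrier := H\<rparr>)\<^esub>" and k: "k \<in> K"
  have kB: "k \<in> carrier B" using subgroup.mem_carrier[OF subgroup_K k] .
  have h: "twist True k \<in> H" "twist False (twist True k) = k"
    using k twist_closed[of k True] twist_twist[of k True] by (simp_all add: H K)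
  have "twist True (a \<otimes> k \<otimes> inv a) = twist True k"
    using fun_cong[OF one, of "twist True k"] h by (simp add: AutoGroup_def BijGroup_def)
  moreover have "a \<otimes> k \<otimes> inv a \<in> assoc True"
    using normal.inv_op_closed2[OF assms(1) a k] by (simp add: K)
  ultimately have "a \<otimes> k \<otimes> inv a = k"
    using twist_twist[of "a \<otimes> k \<otimes> inv a" True] h(2) by simp
  then show "a \<otimes> k = k \<otimes> a" by (rule commute_if_conj_fixed[OF a kB])
qed (rule subgroup_K)

lemma identity_transfer:
  assumes "satisfies_nontrivial_identity (B\<lparr>carrier := assoc (\<not> e)\<rparr>)"
  shows "satisfies_nontrivial_identity (B\<lparr>carrier := assoc e\<rparr>)"
proof (rule identity_pullback[OF assoc_group assoc_group _ _ assms])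
  show "twist e \<in> hom (B\<lparr>carrier := assoc e\<rparr>) (B\<lparr>carrier := assoc (\<not> e)\<rparr>)"
    by (rule homI) simp_all
  show "inj_on (twist e) (carrier (B\<lparr>carrier := assoc e\<rparr>))"
    using bij_twist[of e] by (simp add: bij_betw_def)
qed

end

context separated_hnn
begin

lemma induced_if_same_automorphism:
  assumes "c \<in> carrier B" and "d \<in> carrier B"
    and eq: "(\<lambda>h \<in> H. inv_into H \<phi> ((\<lambda>y \<in> K. inv c \<otimes> y \<otimes> c) (\<phi> h))) = (\<lambda>h \<in> H. inv d \<otimes> h \<otimes> d)"
  shows "induced False c d"
  unfolding induced_def
proof
  fix h assume h: "h \<in> assoc False"
  have th: "twist False h \<in> assoc True" using twist_closed[OF h] by simp
  have "twist True (inv c \<otimes> twist False h \<otimes> c) = inv d \<otimes> h \<otimes> d"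
    using fun_cong[OF eq, of h] h th by (simp add: assoc_def twist_def)
  moreover have "inv c \<otimes> twist False h \<otimes> c \<in> assoc True" by (rule assoc_conj(2)[OF th assms(1)])
  ultimately show "twist False (inv d \<otimes> h \<otimes> d) = inv c \<otimes> twist False h \<otimes> c"
    using twist_twist[of "inv c \<otimes> twist False h \<otimes> c" True] by (simp only: not_True_eq_False)
qed

lemma induced_if_joined:
  assumes "Aut_joined B H K \<phi> = Aut_in B H \<or> Aut_joined B H K \<phi> = Aut_pulled B H K \<phi>"
  shows "(\<forall>c \<in> carrier B. \<exists>d \<in> carrier B. induced False c d)
    \<or> (\<forall>d \<in> carrier B. \<exists>c \<in> carrier B. induced False c d)"
  using assms
proof
  assume "Aut_joined B H K \<phi> = Aut_in B H"
  then have sub: "Aut_pulled B H K \<phi> \<subseteq> Aut_in B H"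
    unfolding Aut_joined_def by (blast intro: generate.incl)
  have "\<exists>d \<in> carrier B. induced False c d" if c: "c \<in> carrier B" for c
  proof -
    let ?p = "\<lambda>h \<in> H. inv_into H \<phi> ((\<lambda>y \<in> K. inv c \<otimes> y \<otimes> c) (\<phi> h))"
    have "?p \<in> Aut_pulled B H K \<phi>"
      unfolding Aut_pulled_def Aut_in_def by (intro imageI c)
    then have "?p \<in> (\<lambda>d. \<lambda>h \<in> H. inv d \<otimes> h \<otimes> d) ` carrier B"
      using sub unfolding Aut_in_def[of B H] by (rule rev_subsetD)
    then obtain d where "?p = (\<lambda>h \<in> H. inv d \<otimes> h \<otimes> d)" and d: "d \<in> carrier B"
      by (rule imageE)
    then have "induced False c d" by (intro induced_if_same_automorphism[OF c])
    then show ?thesis using d by (rule bexI)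
  qed
  then show ?thesis by blast
next
  assume "Aut_joined B H K \<phi> = Aut_pulled B H K \<phi>"
  then have sub: "Aut_in B H \<subseteq> Aut_pulled B H K \<phi>"
    unfolding Aut_joined_def by (blast intro: generate.incl)
  have "\<exists>c \<in> carrier B. induced False c d" if d: "d \<in> carrier B" for d
  proof -
    let ?i = "\<lambda>h \<in> H. inv d \<otimes> h \<otimes> d"
    have "?i \<in> Aut_in B H" unfolding Aut_in_def by (intro imageI d)
    then have "?i \<in> (\<lambda>c. \<lambda>h \<in> H. inv_into H \<phi> ((\<lambda>y \<in> K. inv c \<otimes> y \<otimes> c) (\<phi> h))) ` carrier B"
      using sub unfolding Aut_pulled_def Aut_in_def[of B K] image_image by (rule rev_subsetD)
    then obtain c where "?i = (\<lambda>h \<in> H. inv_into H \<phi> ((\<lambda>y \<in> K. inv c \<otimes> y \<otimes> c) (\<phi> h)))"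
      and c: "c \<in> carrier B"
      by (rule imageE)
    then have "induced False c d" by (intro induced_if_same_automorphism[OF c d HOL.sym])
    then show ?thesis using c by (rule bexI)
  qed
  then show ?thesis by blast
qed

lemma residually_Mod_assoc:
  assumes "satisfies_nontrivial_identity (B\<lparr>carrier := assoc s\<rparr>)
      \<or> (\<forall>c \<in> carrier B. \<exists>d \<in> carrier B. induced s c d)
      \<or> (\<forall>d \<in> carrier B. \<exists>c \<in> carrier B. induced s c d)"
  shows "residually \<C> (B Mod assoc s)"
  by (rule residually_Mod[OF \<C>_group group_axioms normal_assoc separated_quotient[OF assms]])

end

theorem theorem3:
  fixes B :: "('b, 'm) monoid_scheme" and H K :: "'b set" and \<phi> :: "'b \<Rightarrow> 'b"
    and \<C> :: "'u monoid \<Rightarrow> bool"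
  assumes "group B"
    and "H \<lhd> B" and "K \<lhd> B"
    and "\<phi> \<in> iso (B\<lparr>carrier := H\<rparr>) (B\<lparr>carrier := K\<rparr>)"
    and "\<phi> ` (H \<inter> K) = H \<inter> K"
    and "group_class \<C>"
    and "subgroup_closed \<C>" and "quotient_closed \<C>" and "finite_product_closed \<C>"
    and "(Aut_joined B H K \<phi> = Aut_in B H \<or> Aut_joined B H K \<phi> = Aut_pulled B H K \<phi>)
      \<or> (satisfies_nontrivial_identity (B\<lparr>carrier := H\<rparr>)
          \<and> satisfies_nontrivial_identity (B\<lparr>carrier := K\<rparr>))
      \<or> satisfies_nontrivial_identity
          ((AutoGroup (B\<lparr>carrier := H\<rparr>))\<lparr>carrier := Aut_in B H\<rparr>)
      \<or> satisfies_nontrivial_identity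
          ((AutoGroup (B\<lparr>carrier := H\<rparr>))\<lparr>carrier := Aut_pulled B H K \<phi>\<rparr>)"
    and "residually \<C> (HNN B H \<phi>)"
  shows "residually \<C> (B Mod H) \<and> residually \<C> (B Mod K)"
proof -
  interpret group B by fact
  interpret hnn_data B H K \<phi>
    by (intro hnn_data.intro hnn_data_axioms.intro normal_imp_subgroup assms(1-4))
  interpret separated_hnn B H K \<phi> \<C>
    by (intro separated_hnn.intro separated_hnn_axioms.intro hnn_data_axioms assms(2,3,5-8,11))
  have H: "assoc False = H" and K: "assoc True = K" by (simp_all add: assoc_def)
  let ?ident = "\<lambda>s. satisfies_nontrivial_identity (B\<lparr>carrier := assoc s\<rparr>)"
  let ?ind = "\<lambda>s. (\<forall>c \<in> carrier B. \<exists>d \<in> carrier B. induced s c d)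
    \<or> (\<forall>d \<in> carrier B. \<exists>c \<in> carrier B. induced s c d)"
  have "?ind False \<or> ?ident False \<or> ?ident True"
    using assms(10) induced_if_joined identity_H_if_Aut_in[OF assms(2)] identity_K_if_Aut_pulled[OF assms(3)]
    unfolding H K by blast
  moreover have "?ident False \<longleftrightarrow> ?ident True"
    using identity_transfer[of False] identity_transfer[of True] by auto
  moreover have "?ind True" if "?ind False"
    using that induced_swap[of False] by (metis not_False_eq_True)
  ultimately have "?ident False \<or> ?ind False" "?ident True \<or> ?ind True" by argo+
  then show ?thesis
    using residually_Mod_assoc[of False] residually_Mod_assoc[of True] unfolding H K by blast
qed

end
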